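(* Let $k$ be a nonnegative integer and let $q$ be a prime power. Let $S$ be a multiset of integers of size $(q^k-1)/(q-1)$. Then $S$ is $q$-projection-forcing if and only if for each vector $\pi$ that is a permutation of $S$ (that is, each vector $\pi$ of length $(q^k-1)/(q-1)$ whose multiset of entries is $S$), either $M_{k,q}^{-1}\pi$ has all entries nonnegative or $M_{k,q}^{-1}\pi$ contains a non-integer entry.
   Context: Let $\mathbb{F}_q$ be the finite field with $q$ elements. A linear code is a linear subspace of some $\mathbb{F}_q^n$. The Hamming weight $w(v)$ of a vector $v$ is its number of nonzero entries. For a linear code $U$, $P(U)$ is the set of equivalence classes of $U\setminus\{0\}$ under $v_1\sim v_2$ iff $v_1=\alpha v_2$ for some nonzero scalar $\alpha\in\mathbb{F}_q$; $PG(k-1,q)=P(\mathbb{F}_q^k)$, which has $(q^k-1)/(q-1)$ elements. Given linear codes $U\subseteq\mathbb{F}_q^n$, $V\subseteq\mathbb{F}_q^m$ and a linear map $\phi:U\to V$, the projective multiset of weight changes of $\phi$ is the multiset $\{w(u)-w(\phi(u)) : u\in P(U)\}$, where $w(u)-w(\phi(u))$ is computed on any representative (it does not depend on the choice). If $S$ is the projective multiset of weight changes of $\phi$, then $\phi$ realizes $S$. A linear map $\phi:U\to V$ between linear codes $U\subseteq\mathbb{F}_q^n$, $V\subseteq\mathbb{F}_q^m$ is called a projection if it is given by multiplication by a matrix over $\mathbb{F}_q$ with at most one nonzero entry in each row and each column. A multiset $S$ of integers is $q$-projection-forcing if every $\mathbb{F}_q$-linear map between linear codes (with any $n,m$) that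 realizes $S$ is a projection. $M_{k,q}$ is the real matrix which is the complement of the incidence matrix of hyperplanes and points in $PG(k-1,q)$: its rows and columns are indexed by the elements of $PG(k-1,q)$ (in any fixed orders), and its $(v,w)$ entry is $0$ if $v\cdot w=0$ in $\mathbb{F}_q$ and $1$ otherwise, where $v\cdot w$ is the standard dot product of representatives. This matrix is invertible over the reals; $M_{k,q}^{-1}$ denotes its inverse. *)

theory Defs
  imports
    "HOL-Library.Multiset"
    "HOL-Library.Cardinality"
    "Jordan_Normal_Form.Gauss_Jordan_Elimination"
    "Jordan_Normal_Form.VS_Connect"
begin

text \<open>
  The field with q elements is an arbitrary type \<open>'a :: {field, finite}\<close> with
  \<open>CARD('a) = q\<close>. Vectors and matrices of varying dimension are those of
  \<open>Jordan_Normal_Form.Matrix\<close>, so that lengths can be quantified over.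
\<close>

definition linear_code :: "nat \<Rightarrow> ('a :: {field, finite}) vec set \<Rightarrow> bool" where
  "linear_code n U \<longleftrightarrow> VectorSpace.subspace class_ring U (module_vec TYPE('a) n)"

definition code_space :: "nat \<Rightarrow> ('a :: {field, finite}) vec set \<Rightarrow> ('a, 'a vec) module" where
  "code_space n U = (module_vec TYPE('a) n)\<lparr>carrier := U\<rparr>"

text \<open>
  A linear map is a total HOL function; its values outside of \<open>U\<close> are irrelevant.
  The predicate \<open>linear_map\<close> includes that \<open>U\<close> is mapped into \<open>V\<close>.
\<close>

definition code_map ::
  "nat \<Rightarrow> nat \<Rightarrow> ('a :: {field, finite}) vec set \<Rightarrow> 'a vec set \<Rightarrow> ('a vec \<Rightarrow> 'a vec) \<Rightarrow> bool" where
  "code_map n m U V \<phi> \<longleftrightarrow> linear_code n U \<and> linear_code m V \<and>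
     linear_map class_ring (code_space n U) (code_space m V) \<phi>"

definition hamming_weight :: "('a :: zero) vec \<Rightarrow> nat" where
  "hamming_weight v = card {i. i < dim_vec v \<and> v $ i \<noteq> 0}"

definition proportional :: "nat \<Rightarrow> ('a :: field) vec set \<Rightarrow> 'a vec rel" where
  "proportional n U = {(v, w). v \<in> U - {0\<^sub>v n} \<and> w \<in> U - {0\<^sub>v n} \<and>
     (\<exists>\<alpha>. \<alpha> \<noteq> 0 \<and> v = \<alpha> \<cdot>\<^sub>v w)}"

definition proj_points :: "nat \<Rightarrow> ('a :: field) vec set \<Rightarrow> 'a vec set set" where
  "proj_points n U = (U - {0\<^sub>v n}) // proportional n U"

definition representative :: "'a vec set \<Rightarrow> 'a vec" where
  "representative p = (SOME v. v \<in> p)"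

text \<open>\<open>PG k\<close> is the set of points of the projective space of dimension \<open>k - 1\<close>; it is empty
  for \<open>k = 0\<close>.\<close>

definition PG :: "nat \<Rightarrow> ('a :: field) vec set set" where
  "PG k = proj_points k (carrier_vec k)"

definition weight_change :: "(('a :: field) vec \<Rightarrow> 'a vec) \<Rightarrow> 'a vec \<Rightarrow> int" where
  "weight_change \<phi> u = int (hamming_weight u) - int (hamming_weight (\<phi> u))"

definition weight_changes ::
  "nat \<Rightarrow> ('a :: {field, finite}) vec set \<Rightarrow> ('a vec \<Rightarrow> 'a vec) \<Rightarrow> int multiset" where
  "weight_changes n U \<phi> =
     image_mset (\<lambda>p. weight_change \<phi> (representative p)) (mset_set (proj_points n U))"

definition is_projection ::
  "nat \<Rightarrow> nat \<Rightarrow> ('a :: {field, finite}) vec set \<Rightarrow> ('a vec \<Rightarrow> 'a vec) \<Rightarrow> bool" where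
  "is_projection n m U \<phi> \<longleftrightarrow> (\<exists>A \<in> carrier_mat m n.
     (\<forall>i<m. card {j. j < n \<and> A $$ (i, j) \<noteq> 0} \<le> 1) \<and>
     (\<forall>j<n. card {i. i < m \<and> A $$ (i, j) \<noteq> 0} \<le> 1) \<and>
     (\<forall>u\<in>U. \<phi> u = A *\<^sub>v u))"

definition projection_forcing :: "('a :: {field, finite}) itself \<Rightarrow> int multiset \<Rightarrow> bool" where
  "projection_forcing (_ :: 'a itself) S \<longleftrightarrow>
     (\<forall>n m (U :: 'a vec set) V \<phi>.
        code_map n m U V \<phi> \<and> weight_changes n U \<phi> = S \<longrightarrow> is_projection n m U \<phi>)"

text \<open>The lists \<open>rs\<close> and \<open>cs\<close> fix the orders in which the points index rows and columns.\<close>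

definition nonincidence_matrix ::
  "('a :: field) vec set list \<Rightarrow> 'a vec set list \<Rightarrow> real mat" where
  "nonincidence_matrix rs cs = mat (length rs) (length cs)
     (\<lambda>(i, j). if representative (rs ! i) \<bullet> representative (cs ! j) = 0 then 0 else 1)"

definition real_inverse :: "real mat \<Rightarrow> real mat" where
  "real_inverse M = the (mat_inverse M)"

lemma real_inverse_eqI:
  assumes "M \<in> carrier_mat N N" "B \<in> carrier_mat N N" "M * B = 1\<^sub>m N" "B * M = 1\<^sub>m N"
  shows "real_inverse M = B"
proof (cases "mat_inverse M")
  case None
  from mat_inverse(1)[OF assms(1) None] assms show ?thesis
    unfolding Units_def by (auto simp: ring_mat_simps)
next
  case (Some C)
  from mat_inverse(2)[OF assms(1) Some] have C: "C * M = 1\<^sub>m N" "C \<in> carrier_mat N N" by auto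
  have "C = C * (M * B)" using C assms by simp
  also have "\<dots> = (C * M) * B" using C assms by (metis assoc_mult_mat)
  also have "\<dots> = B" using C assms by simp
  finally show ?thesis by (simp add: real_inverse_def Some)
qed

text \<open>Neither the weight change of a point nor the matrix depends on the chosen representatives.\<close>

lemma hamming_weight_smult:
  fixes v :: "('a :: field) vec"
  assumes "\<alpha> \<noteq> 0"
  shows "hamming_weight (\<alpha> \<cdot>\<^sub>v v) = hamming_weight v"
proof -
  have "{i. i < dim_vec (\<alpha> \<cdot>\<^sub>v v) \<and> (\<alpha> \<cdot>\<^sub>v v) $ i \<noteq> 0} = {i. i < dim_vec v \<and> v $ i \<noteq> 0}"
    using assms by auto
  then show ?thesis by (simp add: hamming_weight_def)
qed

lemma weight_change_proportional:
  assumes "code_map n m U V \<phi>" "(v, w) \<in> proportional n U"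
  shows "weight_change \<phi> v = weight_change \<phi> w"
proof -
  from assms(2) obtain \<alpha> where \<alpha>: "\<alpha> \<noteq> 0" "v = \<alpha> \<cdot>\<^sub>v w" and w: "w \<in> U"
    by (auto simp: proportional_def)
  from assms(1) interpret linear_map class_ring "code_space n U" "code_space m V" \<phi>
    by (simp add: code_map_def)
  have "\<phi> (\<alpha> \<cdot>\<^sub>v w) = \<alpha> \<cdot>\<^sub>v \<phi> w"
    using T_smult[of \<alpha> w] w by (simp add: code_space_def module_vec_simps class_ring_simps)
  then show ?thesis using \<alpha> by (simp add: weight_change_def hamming_weight_smult)
qed

lemma dot_zero_proportional:
  assumes "(v, v') \<in> proportional k (carrier_vec k)" "(w, w') \<in> proportional k (carrier_vec k)"
  shows "v \<bullet> w = 0 \<longleftrightarrow> v' \<bullet> w' = 0"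
  using assms by (auto simp: proportional_def)

end

theory Submission
  imports Defs "Jordan_Normal_Form.Determinant"
begin

text \<open>
  Identify \<open>U\<close> with \<open>F\<^sup>k\<close>. The \<open>i\<close>-th coordinates of \<open>u\<close> and of \<open>\<phi> u\<close> become functionals
  \<open>a\<^sub>i \<bullet> x\<close> and \<open>b\<^sub>i \<bullet> x\<close>. Let \<open>\<alpha> p\<close> and \<open>\<beta> p\<close> be the numbers of \<open>a\<^sub>i\<close> and \<open>b\<^sub>i\<close>
  lying in the projective point \<open>p\<close>. Then the vector of weight changes is \<open>M (\<alpha> - \<beta>)\<close>, and \<open>\<phi>\<close> is
  a projection iff \<open>\<beta> \<le> \<alpha>\<close> at every point, since a row of a projection matrix expresses some \<open>b\<^sub>i\<close>
  as a multiple of some \<open>a\<^sub>j\<close>. As \<open>M\<close> is invertible, \<open>M\<^sup>-\<^sup>1 \<pi>\<close> is the integer vector \<open>\<alpha> - \<beta>\<close>.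
  Conversely, an integer vector \<open>y\<close> is \<open>\<alpha> - \<beta>\<close> for \<open>\<alpha> = y\<^sup>+ + 1\<close> and \<open>\<beta> = y\<^sup>- + 1\<close>;
  the summand 1 makes all points occur among the \<open>a\<^sub>i\<close>, so that \<open>x \<mapsto> (a\<^sub>i \<bullet> x)\<^sub>i\<close> is injective.
\<close>

section \<open>Linear codes in coordinates\<close>

lemma linear_code_iff:
  fixes U :: "('a :: {field, finite}) vec set"
  shows "linear_code n U \<longleftrightarrow> U \<subseteq> carrier_vec n \<and> 0\<^sub>v n \<in> U \<and>
     (\<forall>u\<in>U. \<forall>v\<in>U. u + v \<in> U) \<and> (\<forall>c. \<forall>u\<in>U. c \<cdot>\<^sub>v u \<in> U)"
proof -
  interpret vec_space "TYPE('a)" n .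
  show ?thesis
    using vec_vs vec_module
    by (auto simp: linear_code_def VectorSpace.subspace_def submodule_def module_vec_simps class_ring_simps)
qed

lemma linear_code_carrier_vec: "linear_code n (carrier_vec n :: ('a :: {field, finite}) vec set)"
  by (auto simp: linear_code_iff)

lemma code_map_iff:
  fixes U V :: "('a :: {field, finite}) vec set"
  shows "code_map n m U V \<phi> \<longleftrightarrow> linear_code n U \<and> linear_code m V \<and> \<phi> ` U \<subseteq> V \<and>
     (\<forall>u\<in>U. \<forall>v\<in>U. \<phi> (u + v) = \<phi> u + \<phi> v) \<and> (\<forall>c. \<forall>u\<in>U. \<phi> (c \<cdot>\<^sub>v u) = c \<cdot>\<^sub>v \<phi> u)"
proof -
  have vs: "vectorspace class_ring (code_space n U)" if "linear_code n U" for n and U :: "'a vec set"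
  proof -
    interpret vec_space "TYPE('a)" n .
    show ?thesis using that subspace_is_vs unfolding linear_code_def code_space_def by auto
  qed
  then have "linear_map class_ring (code_space n U) (code_space m V) \<phi> \<longleftrightarrow>
      \<phi> \<in> LinearCombinations.module_hom class_ring (code_space n U) (code_space m V)"
    if "linear_code n U" "linear_code m V"
    using that by (auto simp: linear_map_def mod_hom_def mod_hom_axioms_def vectorspace_def)
  moreover have "\<phi> \<in> LinearCombinations.module_hom class_ring (code_space n U) (code_space m V) \<longleftrightarrow>
      \<phi> ` U \<subseteq> V \<and> (\<forall>u\<in>U. \<forall>v\<in>U. \<phi> (u + v) = \<phi> u + \<phi> v) \<and>
      (\<forall>c. \<forall>u\<in>U. \<phi> (c \<cdot>\<^sub>v u) = c \<cdot>\<^sub>v \<phi> u)"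
    by (auto simp: LinearCombinations.module_hom_def code_space_def module_vec_simps class_ring_simps)
  ultimately show ?thesis
    unfolding code_map_def by blast
qed

lemma linear_functional_eq_scalar_prod:
  fixes h :: "('a :: field) vec \<Rightarrow> 'a"
  assumes add: "\<And>x y. x \<in> carrier_vec d \<Longrightarrow> y \<in> carrier_vec d \<Longrightarrow> h (x + y) = h x + h y"
    and smult: "\<And>c x. x \<in> carrier_vec d \<Longrightarrow> h (c \<cdot>\<^sub>v x) = c * h x"
    and x: "x \<in> carrier_vec d"
  shows "h x = vec d (\<lambda>i. h (unit_vec d i)) \<bullet> x"
proof -
  \<comment> \<open>Induction on the number \<open>j\<close> of leading coordinates of
    \<open>x\<close> that are kept; each step adds one multiple of a unit vector, to which
    additivity and homogeneity apply.\<close>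
  have "h (vec d (\<lambda>i. if i < j then x $ i else 0)) = (\<Sum>i<j. h (unit_vec d i) * x $ i)"
    if "j \<le> d" for j
    using that
  proof (induction j)
    case 0
    have "h (0 \<cdot>\<^sub>v 0\<^sub>v d) = 0" using smult[of "0\<^sub>v d" 0] by simp
    moreover have "vec d (\<lambda>i. 0) = 0 \<cdot>\<^sub>v (0\<^sub>v d :: 'a vec)" by auto
    ultimately show ?case by simp
  next
    case (Suc j)
    have "vec d (\<lambda>i. if i < Suc j then x $ i else 0) =
        vec d (\<lambda>i. if i < j then x $ i else 0) + x $ j \<cdot>\<^sub>v unit_vec d j"
      using Suc.prems by (intro eq_vecI) (auto simp: less_Suc_eq)
    then show ?case using Suc by (simp add: add smult mult.commute)
  qed
  from this[of d] have "h (vec d (\<lambda>i. if i < d then x $ i else 0)) = (\<Sum>i<d. h (unit_vec d i) * x $ i)"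
    by simp
  moreover have "vec d (\<lambda>i. if i < d then x $ i else 0) = x"
    using x by (intro eq_vecI) auto
  ultimately show ?thesis
    using x by (simp add: scalar_prod_def lessThan_atLeast0)
qed

text \<open>This is multiplication by the matrix with rows \<open>a 0\<close>, ...,
  \<open>a (n - 1)\<close>; in coding terms the \<open>a i\<close> are the columns of a generator
  matrix. Keeping them as an indexed family makes it possible to count how many lie in a given
  projective point.\<close>

definition encode :: "nat \<Rightarrow> (nat \<Rightarrow> ('a :: field) vec) \<Rightarrow> 'a vec \<Rightarrow> 'a vec" where
  "encode n a x = vec n (\<lambda>i. a i \<bullet> x)"

lemma encode_carrier [simp]: "encode n a x \<in> carrier_vec n"
  by (simp add: encode_def)

lemma encode_add:
  assumes "\<And>i. i < n \<Longrightarrow> a i \<in> carrier_vec k" "x \<in> carrier_vec k" "y \<in> carrier_vec k"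
  shows "encode n a (x + y) = encode n a x + encode n a y"
  using assms by (intro eq_vecI) (simp_all add: encode_def scalar_prod_add_distrib[where n = k])

lemma encode_smult:
  assumes "\<And>i. i < n \<Longrightarrow> a i \<in> carrier_vec k" "x \<in> carrier_vec k"
  shows "encode n a (c \<cdot>\<^sub>v x) = c \<cdot>\<^sub>v encode n a x"
  using assms by (auto simp: encode_def)

lemma encode_zero:
  assumes "\<And>i. i < n \<Longrightarrow> a i \<in> carrier_vec k"
  shows "encode n a (0\<^sub>v k) = 0\<^sub>v n"
  using assms by (auto simp: encode_def)

text \<open>Each coordinate of \<open>f\<close> is a linear functional. This is applied twice: to a
  parametrization of \<open>U\<close>, and to its composition with the code map.\<close>

lemma linear_eq_encode:
  fixes f :: "('a :: field) vec \<Rightarrow> 'a vec"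
  assumes f: "\<And>x. x \<in> carrier_vec d \<Longrightarrow> f x \<in> carrier_vec n"
    and add: "\<And>x y. x \<in> carrier_vec d \<Longrightarrow> y \<in> carrier_vec d \<Longrightarrow> f (x + y) = f x + f y"
    and smult: "\<And>c x. x \<in> carrier_vec d \<Longrightarrow> f (c \<cdot>\<^sub>v x) = c \<cdot>\<^sub>v f x"
  shows "\<exists>a. (\<forall>i. a i \<in> carrier_vec d) \<and> (\<forall>x\<in>carrier_vec d. f x = encode n a x)"
proof (intro exI conjI ballI allI)
  fix x :: "'a vec" assume x: "x \<in> carrier_vec d"
  have "f x $ i = vec d (\<lambda>j. f (unit_vec d j) $ i) \<bullet> x" if i: "i < n" for i
    using i x
    by (intro linear_functional_eq_scalar_prod[where h = "\<lambda>x. f x $ i"])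
       (simp_all add: add smult carrier_vecD[OF f])
  then show "f x = encode n (\<lambda>i. vec d (\<lambda>j. f (unit_vec d j) $ i)) x"
    using carrier_vecD[OF f[OF x]] by (intro eq_vecI) (auto simp: encode_def)
qed auto

section \<open>Finiteness and parametrization of codes\<close>

lemma card_carrier_vec:
  "card (carrier_vec d :: ('a :: finite) vec set) = CARD('a) ^ d"
proof -
  have "bij_betw list_of_vec (carrier_vec d :: 'a vec set) {xs. set xs \<subseteq> UNIV \<and> length xs = d}"
  proof (rule bij_betw_byWitness[where f' = vec_of_list])
    show "list_of_vec ` (carrier_vec d :: 'a vec set) \<subseteq> {xs. set xs \<subseteq> UNIV \<and> length xs = d}"
      by (auto simp only: carrier_vec_def Matrix.length_list_of_vec)
    show "vec_of_list ` {xs :: 'a list. set xs \<subseteq> UNIV \<and> length xs = d} \<subseteq> carrier_vec d"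
      by (auto simp only: carrier_vec_def dim_vec_of_list)
  qed (auto simp only: vec_list list_vec)
  from bij_betw_same_card[OF this] show ?thesis by (simp only: card_lists_length_eq[OF finite])
qed

lemma finite_carrier_vec: "finite (carrier_vec d :: ('a :: finite) vec set)"
proof (rule card_ge_0_finite)
  show "0 < card (carrier_vec d :: 'a vec set)" by (simp add: card_carrier_vec)
qed

lemma linear_code_finite: "linear_code n U \<Longrightarrow> finite U"
  unfolding linear_code_iff using finite_carrier_vec finite_subset by blast

lemma two_le_card_field: "2 \<le> CARD('a :: {field, finite})"
proof -
  have "card {0, 1 :: 'a} \<le> CARD('a)" by (rule card_mono) auto
  then show ?thesis by simp
qed

text \<open>The extension step in constructing a basis: the last unit vector is sent to some
  \<open>u\<close> in \<open>U\<close> outside the image of \<open>f\<close>, and the first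
  \<open>d\<close> coordinates are still mapped by \<open>f\<close>.\<close>

lemma linear_code_extend_injection:
  fixes U :: "('a :: {field, finite}) vec set"
  assumes U: "linear_code n U"
    and f: "f ` carrier_vec d \<subseteq> U" "f ` carrier_vec d \<noteq> U" "inj_on f (carrier_vec d)"
    and add: "\<And>x y. x \<in> carrier_vec d \<Longrightarrow> y \<in> carrier_vec d \<Longrightarrow> f (x + y) = f x + f y"
    and smult: "\<And>c x. x \<in> carrier_vec d \<Longrightarrow> f (c \<cdot>\<^sub>v x) = c \<cdot>\<^sub>v f x"
  shows "\<exists>g. g ` carrier_vec (Suc d) \<subseteq> U \<and> inj_on g (carrier_vec (Suc d)) \<and>
     (\<forall>x\<in>carrier_vec (Suc d). \<forall>y\<in>carrier_vec (Suc d). g (x + y) = g x + g y) \<and>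
     (\<forall>c. \<forall>x\<in>carrier_vec (Suc d). g (c \<cdot>\<^sub>v x) = c \<cdot>\<^sub>v g x)"
proof -
  from f obtain u where u: "u \<in> U" "u \<notin> f ` carrier_vec d" by auto
  have Uc: "U \<subseteq> carrier_vec n" and Uadd: "\<And>x y. x \<in> U \<Longrightarrow> y \<in> U \<Longrightarrow> x + y \<in> U"
    and Usm: "\<And>c x. x \<in> U \<Longrightarrow> c \<cdot>\<^sub>v x \<in> U"
    using U by (auto simp: linear_code_iff)
  define r :: "'a vec \<Rightarrow> 'a vec" where "r x = vec d (\<lambda>i. x $ i)" for x
  have r[simp]: "r x \<in> carrier_vec d" for x by (simp add: r_def)
  define g where "g x = f (r x) + x $ d \<cdot>\<^sub>v u" for x
  have fU: "f (r x) \<in> U" for x using f(1) by auto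
  then have fc: "f (r x) \<in> carrier_vec n" for x using Uc by auto
  have uc: "u \<in> carrier_vec n" using u Uc by auto
  have gadd: "g (x + y) = g x + g y"
    if xy: "x \<in> carrier_vec (Suc d)" "y \<in> carrier_vec (Suc d)" for x y
  proof -
    have "r (x + y) = r x + r y" using xy by (auto simp: r_def)
    then have "g (x + y) = (f (r x) + f (r y)) + (x $ d + y $ d) \<cdot>\<^sub>v u"
      using xy by (simp add: g_def add)
    then show ?thesis using fc[of x] fc[of y] uc
      by (intro eq_vecI) (auto simp: g_def algebra_simps)
  qed
  have gsm: "g (c \<cdot>\<^sub>v x) = c \<cdot>\<^sub>v g x" if x: "x \<in> carrier_vec (Suc d)" for c x
  proof -
    have "r (c \<cdot>\<^sub>v x) = c \<cdot>\<^sub>v r x" using x by (auto simp: r_def)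
    then have "g (c \<cdot>\<^sub>v x) = c \<cdot>\<^sub>v f (r x) + (c * x $ d) \<cdot>\<^sub>v u"
      using x by (simp add: g_def smult)
    then show ?thesis using fc[of x] uc
      by (intro eq_vecI) (auto simp: g_def algebra_simps)
  qed
  have "inj_on g (carrier_vec (Suc d))"
  proof (rule inj_onI)
    fix x y assume xy: "x \<in> carrier_vec (Suc d)" "y \<in> carrier_vec (Suc d)" "g x = g y"
    have eqi: "f (r x) $ i + x $ d * u $ i = f (r y) $ i + y $ d * u $ i" if "i < n" for i
      using arg_cong[OF xy(3), of "\<lambda>v. v $ i"] that fc uc by (auto simp: g_def)
    \<comment> \<open>Otherwise (x_d - y_d) u = f (r y) - f (r x) could be divided by x_d - y_d,
      which would put \<open>u\<close> into the image of \<open>f\<close>.\<close>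
    have d: "x $ d = y $ d"
    proof (rule ccontr)
      assume ne: "x $ d \<noteq> y $ d"
      define c where "c = inverse (x $ d - y $ d)"
      have c: "c * (x $ d - y $ d) = 1" using ne by (simp add: c_def)
      have "f (c \<cdot>\<^sub>v (r y + (-1) \<cdot>\<^sub>v r x)) = c \<cdot>\<^sub>v (f (r y) + (-1) \<cdot>\<^sub>v f (r x))"
        by (simp add: add smult)
      also have "\<dots> = u"
      proof (rule eq_vecI)
        fix i assume "i < dim_vec u"
        then have i: "i < n" using uc by simp
        have "c * (f (r y) $ i - f (r x) $ i) = c * (x $ d - y $ d) * u $ i"
        proof -
          have "f (r y) $ i - f (r x) $ i = (x $ d - y $ d) * u $ i"
            using eqi[OF i] by (simp add: left_diff_distrib eq_diff_eq[symmetric])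
          then show ?thesis by simp
        qed
        then show "(c \<cdot>\<^sub>v (f (r y) + (-1) \<cdot>\<^sub>v f (r x))) $ i = u $ i"
          using i c carrier_vecD[OF fc] by simp
      qed (use carrier_vecD[OF fc] uc in simp)
      finally have "u \<in> f ` carrier_vec d" by (metis add_carrier_vec imageI r smult_carrier_vec)
      with u show False by simp
    qed
    have "f (r x) = f (r y)"
      using eqi d carrier_vecD[OF fc] by (intro eq_vecI) auto
    then have "r x = r y" using f(3) by (meson inj_onD r)
    then have "x $ i = y $ i" if "i < d" for i
      using that by (auto simp: r_def dest: arg_cong[where f = "\<lambda>v. v $ i"])
    with d xy show "x = y"
      by (intro eq_vecI) (auto simp: less_Suc_eq)
  qed
  moreover have "g ` carrier_vec (Suc d) \<subseteq> U"
    unfolding g_def using fU u Uadd Usm by auto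
  ultimately show ?thesis using gadd gsm by blast
qed

text \<open>Take the largest \<open>d\<close> that admits a linear injection of F^d into
  \<open>U\<close>. It exists because d < 2^d, which is at most q^d and hence at most the size of
  \<open>U\<close>. By maximality the injection cannot be extended, so it is onto.\<close>

lemma linear_code_eq_encode:
  fixes U :: "('a :: {field, finite}) vec set"
  assumes U: "linear_code n U"
  shows "\<exists>d a. (\<forall>i. a i \<in> carrier_vec d) \<and> bij_betw (encode n a) (carrier_vec d) U"
proof -
  define Q where "Q d f \<longleftrightarrow> f ` carrier_vec d \<subseteq> U \<and> inj_on f (carrier_vec d) \<and>
     (\<forall>x\<in>carrier_vec d. \<forall>y\<in>carrier_vec d. f (x + y) = f x + f y) \<and>
     (\<forall>c. \<forall>x\<in>carrier_vec d. f (c \<cdot>\<^sub>v x) = c \<cdot>\<^sub>v f x)" for d and f :: "'a vec \<Rightarrow> 'a vec"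
  have Q0: "Q 0 (\<lambda>_. 0\<^sub>v n)"
    using U by (auto simp: Q_def linear_code_iff intro!: inj_onI)
  have bound: "d \<le> card U" if "Q d f" for d f
  proof -
    have "2 ^ d \<le> CARD('a) ^ d" using two_le_card_field by (rule power_mono) simp
    also have "\<dots> \<le> card U"
      using that card_inj_on_le[of f "carrier_vec d" U] linear_code_finite[OF U]
      by (simp add: Q_def card_carrier_vec)
    finally show ?thesis using less_exp[of d] by linarith
  qed
  define d where "d = (GREATEST d. \<exists>f. Q d f)"
  have ex: "\<exists>f. Q 0 f" using Q0 by blast
  have bd: "e \<le> card U" if "\<exists>f. Q e f" for e using that bound by blast
  have "\<exists>f. Q d f" unfolding d_def
    using GreatestI_nat[where P = "\<lambda>d. \<exists>f. Q d f", OF ex bd] .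
  then obtain f where f: "Q d f" by blast
  have "f ` carrier_vec d = U"
  proof (rule ccontr)
    assume "f ` carrier_vec d \<noteq> U"
    then have "\<exists>g. Q (Suc d) g" unfolding Q_def
      using f by (intro linear_code_extend_injection[OF U, of f]) (auto simp: Q_def)
    then have "Suc d \<le> d" unfolding d_def
      using Greatest_le_nat[where P = "\<lambda>d. \<exists>f. Q d f", OF _ bd] by blast
    then show False by simp
  qed
  then have bij: "bij_betw f (carrier_vec d) U" using f by (auto simp: Q_def bij_betw_def)
  have "f x \<in> carrier_vec n" if "x \<in> carrier_vec d" for x
    using that f U by (auto simp: Q_def linear_code_iff)
  then obtain a where a: "\<forall>i. a i \<in> carrier_vec d" "\<forall>x\<in>carrier_vec d. f x = encode n a x"
    using linear_eq_encode[of d f n] f by (auto simp: Q_def)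
  then have "bij_betw (encode n a) (carrier_vec d) U"
    using bij bij_betw_cong[of "carrier_vec d" f "encode n a" U] by simp
  with a(1) show ?thesis by blast
qed

section \<open>Projective points\<close>

text \<open>Unlike \<open>proportional\<close>, this mentions no ambient code, so the same notion
  serves for \<open>U\<close> and for F^k. The zero vector gives {0}, which is not a member of
  \<open>PG k\<close>.\<close>

definition point :: "('a :: field) vec \<Rightarrow> 'a vec set" where
  "point v = {c \<cdot>\<^sub>v v | c. c \<noteq> 0}"

lemma point_self: "v \<in> point v"
  unfolding point_def using one_smult_vec[of v] by fastforce

lemma point_eqI: "w \<in> point v \<Longrightarrow> point w = point v"
proof -
  assume "w \<in> point v"
  then obtain c where c: "c \<noteq> 0" "w = c \<cdot>\<^sub>v v" by (auto simp: point_def)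
  have "d \<cdot>\<^sub>v v = (d / c) \<cdot>\<^sub>v w" for d using c by (simp add: smult_smult_assoc)
  moreover have "d \<cdot>\<^sub>v w = (d * c) \<cdot>\<^sub>v v" for d using c by (simp add: smult_smult_assoc)
  ultimately show ?thesis using c(1) unfolding point_def
    by (metis (no_types, lifting) divide_eq_0_iff mult_eq_0_iff)
qed

text \<open>A code is closed under scaling, so the class of a nonzero codeword consists of all its
  nonzero multiples and the restriction to \<open>U\<close> in \<open>proportional\<close>
  disappears.\<close>

lemma proj_points_eq:
  fixes U :: "('a :: {field, finite}) vec set"
  assumes U: "linear_code n U"
  shows "proj_points n U = point ` (U - {0\<^sub>v n})"
proof -
  have "proportional n U `` {v} = point v" if v: "v \<in> U - {0\<^sub>v n}" for v
  proof (intro equalityI subsetI)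
    fix w assume "w \<in> proportional n U `` {v}"
    then obtain c where "c \<noteq> 0" "v = c \<cdot>\<^sub>v w" by (auto simp: proportional_def)
    then have "v \<in> point w" by (auto simp: point_def)
    then show "w \<in> point v" using point_eqI point_self by blast
  next
    fix w assume "w \<in> point v"
    then obtain c where c: "c \<noteq> 0" "w = c \<cdot>\<^sub>v v" by (auto simp: point_def)
    have "v = inverse c \<cdot>\<^sub>v w" using c by (auto simp: smult_smult_assoc)
    moreover from this have "w \<noteq> 0\<^sub>v n" using v by auto
    moreover have "w \<in> U" using U v c by (auto simp: linear_code_iff)
    ultimately show "w \<in> proportional n U `` {v}"
      using v c unfolding proportional_def by (auto intro!: exI[of _ "inverse c"])
  qed
  then show ?thesis unfolding proj_points_def quotient_def by auto
qed

lemma representative_point: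
  assumes U: "linear_code n U" and p: "p \<in> proj_points n U"
  shows "representative p \<in> U - {0\<^sub>v n}" and "point (representative p) = p"
    and "representative p \<in> p"
proof -
  from p obtain v where v: "v \<in> U - {0\<^sub>v n}" "p = point v" by (auto simp: proj_points_eq[OF U])
  show r: "representative p \<in> p"
    unfolding representative_def using point_self v by (metis someI)
  then show pr: "point (representative p) = p" using point_eqI v by blast
  from r v obtain c where c: "c \<noteq> 0" "representative p = c \<cdot>\<^sub>v v" by (auto simp: point_def)
  then have "v = inverse c \<cdot>\<^sub>v representative p" by (auto simp: smult_smult_assoc)
  then have "representative p \<noteq> 0\<^sub>v n" using v by auto
  then show "representative p \<in> U - {0\<^sub>v n}" using c v U by (auto simp: linear_code_iff)
qed

lemmas PG_eq = proj_points_eq[OF linear_code_carrier_vec, folded PG_def]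
lemmas representative_PG = representative_point[OF linear_code_carrier_vec, folded PG_def]

lemma point_smult_eq_0:
  assumes "v \<in> carrier_vec k" "w \<in> point v" "x \<in> carrier_vec k"
  shows "w \<bullet> x = 0 \<longleftrightarrow> v \<bullet> x = 0" and "x \<bullet> w = 0 \<longleftrightarrow> x \<bullet> v = 0"
  using assms by (auto simp: point_def)

lemma card_point:
  fixes v :: "('a :: {field, finite}) vec"
  assumes "v \<in> carrier_vec n - {0\<^sub>v n}"
  shows "card (point v) = CARD('a) - 1"
proof -
  from assms obtain i where i: "i < n" "v $ i \<noteq> 0"
    by (metis DiffD1 DiffD2 carrier_vecD eq_vecI index_zero_vec singletonI)
  have "inj_on (\<lambda>c. c \<cdot>\<^sub>v v) (UNIV - {0})"
  proof (rule inj_onI)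
    fix c d assume "c \<cdot>\<^sub>v v = d \<cdot>\<^sub>v v"
    then have "c * v $ i = d * v $ i"
      using i assms by (metis DiffD1 carrier_vecD index_smult_vec(1))
    then show "c = d" using i by simp
  qed
  moreover have "point v = (\<lambda>c. c \<cdot>\<^sub>v v) ` (UNIV - {0})" by (auto simp: point_def)
  ultimately show ?thesis by (simp add: card_image card_Diff_singleton)
qed

text \<open>The nonzero vectors are the disjoint union of the points, and each point has q - 1
  vectors, on which \<open>f\<close> is constant. The general semiring covers both the counting of
  points in the naturals and the real sums behind the inverse matrix.\<close>

lemma sum_nonzero_vectors:
  fixes f :: "('a :: {field, finite}) vec \<Rightarrow> 'b :: comm_semiring_1"
  assumes U: "linear_code n U"
    and f: "\<And>v w. v \<in> U \<Longrightarrow> w \<in> point v \<Longrightarrow> f w = f v"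
  shows "(\<Sum>v\<in>U - {0\<^sub>v n}. f v) = of_nat (CARD('a) - 1) * (\<Sum>p\<in>proj_points n U. f (representative p))"
proof -
  have Un: "U - {0\<^sub>v n} = \<Union> (proj_points n U)"
  proof (intro equalityI subsetI)
    fix v assume "v \<in> U - {0\<^sub>v n}"
    then show "v \<in> \<Union> (proj_points n U)" using point_self by (auto simp: proj_points_eq[OF U])
  next
    fix v assume "v \<in> \<Union> (proj_points n U)"
    then obtain w c where w: "w \<in> U - {0\<^sub>v n}" and c: "c \<noteq> 0" "v = c \<cdot>\<^sub>v w"
      by (auto simp: proj_points_eq[OF U] point_def)
    have "w = inverse c \<cdot>\<^sub>v v" using c by (auto simp: smult_smult_assoc)
    then have "v \<noteq> 0\<^sub>v n" using w by auto
    then show "v \<in> U - {0\<^sub>v n}" using w c U by (auto simp: linear_code_iff)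
  qed
  have fin: "finite p" if "p \<in> proj_points n U" for p
  proof (rule finite_subset)
    show "p \<subseteq> U - {0\<^sub>v n}" using Un that by auto
    show "finite (U - {0\<^sub>v n})" using linear_code_finite[OF U] by simp
  qed
  have disj: "p \<inter> p' = {}" if "p \<in> proj_points n U" "p' \<in> proj_points n U" "p \<noteq> p'" for p p'
    using that point_eqI unfolding proj_points_eq[OF U] by blast
  have "(\<Sum>v\<in>U - {0\<^sub>v n}. f v) = (\<Sum>p\<in>proj_points n U. \<Sum>v\<in>p. f v)"
    unfolding Un using fin disj by (intro sum.Union_disjoint[unfolded comp_def]) auto
  also have "\<dots> = (\<Sum>p\<in>proj_points n U. of_nat (CARD('a) - 1) * f (representative p))"
  proof (intro sum.cong refl)
    fix p assume p: "p \<in> proj_points n U"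
    note r = representative_point[OF U p]
    have "(\<Sum>v\<in>p. f v) = (\<Sum>v\<in>p. f (representative p))"
      using r by (intro sum.cong refl f) auto
    also have "\<dots> = of_nat (card p) * f (representative p)" by simp
    also have "card p = CARD('a) - 1"
      using r card_point[of "representative p" n] U by (auto simp: linear_code_iff)
    finally show "(\<Sum>v\<in>p. f v) = of_nat (CARD('a) - 1) * f (representative p)" .
  qed
  finally show ?thesis by (simp add: sum_distrib_left)
qed

lemma card_proj_points:
  fixes U :: "('a :: {field, finite}) vec set"
  assumes U: "linear_code n U"
  shows "card U - 1 = (CARD('a) - 1) * card (proj_points n U)"
proof -
  have "0\<^sub>v n \<in> U" using U by (simp add: linear_code_iff)
  then have "card U - 1 = (\<Sum>v\<in>U - {0\<^sub>v n}. 1)" by (simp add: card_Diff_singleton)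
  also have "\<dots> = (CARD('a) - 1) * card (proj_points n U)"
    using sum_nonzero_vectors[OF U, of "\<lambda>_. 1 :: nat"] by simp
  finally show ?thesis .
qed

lemma finite_proj_points: "linear_code n U \<Longrightarrow> finite (proj_points n U)"
  by (simp add: proj_points_eq linear_code_finite)

section \<open>The inverse of the nonincidence matrix\<close>

text \<open>Since the functional does not vanish at \<open>w0\<close>, \<open>W\<close> is the
  direct sum of its kernel and the line spanned by \<open>w0\<close>. Allowing any code
  \<open>W\<close> makes this applicable to a hyperplane as well as to the whole space.\<close>

lemma card_kernel:
  fixes W :: "('a :: {field, finite}) vec set"
  assumes W: "linear_code k W" and a: "a \<in> carrier_vec k" and w0: "w0 \<in> W" "a \<bullet> w0 \<noteq> 0"
  shows "card W = CARD('a) * card {w \<in> W. a \<bullet> w = 0}"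
proof -
  have Wc: "w \<in> carrier_vec k" if "w \<in> W" for w using W that by (auto simp: linear_code_iff)
  have Wadd: "w + c \<cdot>\<^sub>v w' \<in> W" if "w \<in> W" "w' \<in> W" for w w' c
    using W that by (auto simp: linear_code_iff)
  \<comment> \<open>The coefficient of \<open>w0\<close> in \<open>w\<close>: subtracting
    \<open>t w\<close> times \<open>w0\<close> lands in the kernel.\<close>
  define t where "t w = a \<bullet> w / (a \<bullet> w0)" for w
  have dot: "a \<bullet> (w + c \<cdot>\<^sub>v w0) = a \<bullet> w + c * (a \<bullet> w0)" if "w \<in> W" for w c
    using Wc[OF that] Wc[OF w0(1)] a by (simp add: scalar_prod_add_distrib[where n = k])
  have cancel: "(w + c \<cdot>\<^sub>v w0) + (- c) \<cdot>\<^sub>v w0 = w" "(w + (- c) \<cdot>\<^sub>v w0) + c \<cdot>\<^sub>v w0 = w"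
    if "w \<in> W" for w c
    using Wc[OF that] Wc[OF w0(1)] by (auto intro!: eq_vecI)
  have "bij_betw (\<lambda>(c, w). w + c \<cdot>\<^sub>v w0) (UNIV \<times> {w \<in> W. a \<bullet> w = 0}) W"
  proof (rule bij_betw_byWitness[where f' = "\<lambda>w. (t w, w + (- t w) \<cdot>\<^sub>v w0)"])
    have "t (w + c \<cdot>\<^sub>v w0) = c" if "w \<in> W" "a \<bullet> w = 0" for w c
      using that w0 by (simp add: t_def dot)
    then show "\<forall>cw\<in>UNIV \<times> {w \<in> W. a \<bullet> w = 0}.
        (t (case cw of (c, w) \<Rightarrow> w + c \<cdot>\<^sub>v w0),
         (case cw of (c, w) \<Rightarrow> w + c \<cdot>\<^sub>v w0) + (- t (case cw of (c, w) \<Rightarrow> w + c \<cdot>\<^sub>v w0)) \<cdot>\<^sub>v w0) = cw"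
      by (auto simp: cancel)
    show "\<forall>w\<in>W. (case (t w, w + (- t w) \<cdot>\<^sub>v w0) of (c, w) \<Rightarrow> w + c \<cdot>\<^sub>v w0) = w"
      by (auto simp: cancel)
    show "(\<lambda>(c, w). w + c \<cdot>\<^sub>v w0) ` (UNIV \<times> {w \<in> W. a \<bullet> w = 0}) \<subseteq> W"
      using Wadd w0 by auto
    show "(\<lambda>w. (t w, w + (- t w) \<cdot>\<^sub>v w0)) ` W \<subseteq> UNIV \<times> {w \<in> W. a \<bullet> w = 0}"
    proof (rule image_subsetI)
      fix w assume w: "w \<in> W"
      have "w + (- t w) \<cdot>\<^sub>v w0 \<in> W" using Wadd w w0 by blast
      moreover have "a \<bullet> (w + (- t w) \<cdot>\<^sub>v w0) = 0"
        unfolding dot[OF w] using w0(2) by (simp add: t_def)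
      ultimately show "(t w, w + (- t w) \<cdot>\<^sub>v w0) \<in> UNIV \<times> {w \<in> W. a \<bullet> w = 0}" by blast
    qed
  qed
  from bij_betw_same_card[OF this] show ?thesis by (simp add: card_cartesian_product)
qed

lemma linear_code_kernel:
  fixes a :: "('a :: {field, finite}) vec"
  assumes "a \<in> carrier_vec k"
  shows "linear_code k {w \<in> carrier_vec k. a \<bullet> w = 0}"
  using assms by (auto simp: linear_code_iff scalar_prod_add_distrib[where n = k])

lemma nonzero_component:
  assumes "v \<in> carrier_vec k" "v \<noteq> 0\<^sub>v k"
  obtains i where "i < k" "v $ i \<noteq> 0"
  using assms by (metis carrier_vecD eq_vecI index_zero_vec(1,2))

text \<open>Two distinct points define distinct hyperplanes. With v'_i nonzero, the vectors v'_i e_j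
  - v'_j e_i are all orthogonal to \<open>v'\<close>; if all were orthogonal to \<open>v\<close>
  too, \<open>v\<close> would be a multiple of \<open>v'\<close>.\<close>

lemma independent_separating_vector:
  fixes v v' :: "('a :: field) vec"
  assumes v: "v \<in> carrier_vec k" and v': "v' \<in> carrier_vec k"
    and nz: "v \<noteq> 0\<^sub>v k" "v' \<noteq> 0\<^sub>v k" and ne: "point v \<noteq> point v'"
  obtains w where "w \<in> carrier_vec k" "v' \<bullet> w = 0" "v \<bullet> w \<noteq> 0"
proof -
  obtain i where i: "i < k" "v' $ i \<noteq> 0" using nonzero_component v' nz by blast
  define w where "w j = v' $ i \<cdot>\<^sub>v unit_vec k j + (- v' $ j) \<cdot>\<^sub>v unit_vec k i" for j
  have w: "w j \<in> carrier_vec k" for j by (simp add: w_def)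
  have dot: "u \<bullet> w j = v' $ i * u $ j - v' $ j * u $ i" if "u \<in> carrier_vec k" "j < k" for u j
    using that i by (simp add: w_def scalar_prod_add_distrib[where n = k])
  have "\<exists>j<k. v \<bullet> w j \<noteq> 0"
  proof (rule ccontr)
    assume "\<not> (\<exists>j<k. v \<bullet> w j \<noteq> 0)"
    then have "v $ j = v $ i / v' $ i * v' $ j" if "j < k" for j
      using that i dot[OF v] by (simp add: field_simps)
    then have vv: "v = (v $ i / v' $ i) \<cdot>\<^sub>v v'"
      using v v' by (intro eq_vecI) auto
    have "0 \<cdot>\<^sub>v v' = 0\<^sub>v k" using v' by auto
    with vv nz have "v $ i / v' $ i \<noteq> 0" by metis
    with vv have "v \<in> point v'" unfolding point_def by blast
    with ne point_eqI show False by blast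
  qed
  then obtain j where "j < k" "v \<bullet> w j \<noteq> 0" by blast
  with that[of "w j"] w dot[OF v'] show thesis by simp
qed

text \<open>The summand is an entry of M in row \<open>v\<close> times q^(k-1) times an entry in
  column \<open>v'\<close> of the candidate inverse. The sum counts vectors outside the hyperplane
  of \<open>v\<close>, minus q times those of them in the hyperplane of \<open>v'\<close>. For equal
  points the second set is empty; for distinct points the two terms cancel. The factor q - 1 appears
  because vectors are summed instead of points.\<close>

lemma sum_nonincidence_orthogonality:
  fixes v v' :: "('a :: {field, finite}) vec"
  assumes v: "v \<in> carrier_vec k" and v': "v' \<in> carrier_vec k"
    and nz: "v \<noteq> 0\<^sub>v k" "v' \<noteq> 0\<^sub>v k"
  defines "q \<equiv> CARD('a)"
  shows "(\<Sum>w\<in>carrier_vec k - {0\<^sub>v k}.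
      if v \<bullet> w = 0 then 0 else if v' \<bullet> w = 0 then 1 - real q else 1) =
    (if point v = point v' then real (q - 1) * real q ^ (k - 1) else 0)"
proof -
  let ?C = "carrier_vec k :: 'a vec set"
  define K where "K u = {w \<in> ?C. u \<bullet> w = 0}" for u
  have fin: "finite ?C" "finite (K u)" for u using finite_carrier_vec[where 'a = 'a and d = k] by (auto simp: K_def)
  obtain i where i: "i < k" using nonzero_component v nz by blast
  have q: "real (q - 1) = real q - 1" using two_le_card_field[where 'a = 'a] by (simp add: q_def)
  have cardK: "card (K u) = q ^ (k - 1)" if u: "u \<in> ?C" "u \<noteq> 0\<^sub>v k" for u
  proof -
    obtain j where j: "j < k" "u $ j \<noteq> 0" using nonzero_component u by blast
    then have "card ?C = q * card (K u)" unfolding K_def q_def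
      using u by (intro card_kernel[OF linear_code_carrier_vec, of u k "unit_vec k j"]) auto
    moreover have "card ?C = q * q ^ (k - 1)"
      using i unfolding card_carrier_vec q_def by (metis power_eq_if not_less0)
    ultimately show ?thesis using two_le_card_field[where 'a = 'a] by (simp add: q_def)
  qed
  let ?f = "\<lambda>w. if v \<bullet> w = 0 then 0 else if v' \<bullet> w = 0 then 1 - real q else 1"
  have "(\<Sum>w\<in>?C - {0\<^sub>v k}. ?f w) = (\<Sum>w\<in>?C. ?f w)"
    using v by (intro sum.mono_neutral_left fin) auto
  \<comment> \<open>Off \<open>K v\<close> the weight is 1, lowered by q exactly on
    \<open>K v' - K v\<close>, where it becomes 1 - q.\<close>
  also have "\<dots> = (\<Sum>w\<in>?C. of_bool (w \<in> ?C - K v) - real q * of_bool (w \<in> K v' - K v))"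
    by (intro sum.cong) (auto simp: K_def)
  also have "\<dots> = real (card (?C - K v)) - real q * real (card (K v' - K v))"
  proof -
    have ind: "(\<Sum>w\<in>?C. of_bool (w \<in> A)) = real (card A)" if "A \<subseteq> ?C" for A
      using that fin(1) by (simp add: sum_of_bool_eq Int_absorb1)
    have "?C - K v \<subseteq> ?C" "K v' - K v \<subseteq> ?C" by (auto simp: K_def)
    then show ?thesis by (simp only: sum_subtractf sum_distrib_left[symmetric] ind)
  qed
  also have "real (card (?C - K v)) = real q * real q ^ (k - 1) - real q ^ (k - 1)"
  proof -
    have "K v \<subseteq> ?C" by (auto simp: K_def)
    then have "real (card (?C - K v)) = real (card ?C) - real (card (K v))"
      using fin by (simp add: card_Diff_subset card_mono of_nat_diff)
    moreover have "real (card ?C) = real q * real q ^ (k - 1)"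
      using i unfolding card_carrier_vec q_def by (metis of_nat_power power_eq_if not_less0)
    ultimately show ?thesis using cardK v nz by simp
  qed
  also have "real q * real (card (K v' - K v)) =
      (if point v = point v' then 0 else real q * real q ^ (k - 1) - real q ^ (k - 1))"
  proof (cases "point v = point v'")
    case True
    then obtain c where "c \<noteq> 0" "v' = c \<cdot>\<^sub>v v" using point_self[of v'] by (auto simp: point_def)
    then have "K v' = K v" using v by (auto simp: K_def)
    then show ?thesis using True by simp
  next
    case False
    then obtain w where w: "w \<in> ?C" "v' \<bullet> w = 0" "v \<bullet> w \<noteq> 0"
      using independent_separating_vector v v' nz by metis
    \<comment> \<open>The kernel count is used inside the hyperplane \<open>K v'\<close>, on which
      \<open>w\<close> shows that \<open>v\<close> does not vanish. Leaving the factor q in place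
      avoids the exponent k - 2.\<close>
    have "card (K v') = q * card {w \<in> K v'. v \<bullet> w = 0}" unfolding q_def
      using w v v' by (intro card_kernel[of k "K v'" v w]) (auto simp: K_def linear_code_kernel)
    moreover have "{w \<in> K v'. v \<bullet> w = 0} = K v' \<inter> K v" by (auto simp: K_def)
    moreover have "real (card (K v' - K v)) = real (card (K v')) - real (card (K v' \<inter> K v))"
      using fin by (simp add: card_Diff_subset_Int card_mono of_nat_diff)
    ultimately show ?thesis
      using False cardK[OF v' nz(2)] by (simp add: right_diff_distrib flip: of_nat_mult of_nat_power)
  qed
  finally show ?thesis unfolding q left_diff_distrib by simp
qed

lemma real_inverse_nonincidence_matrix:
  fixes rs cs :: "('a :: {field, finite}) vec set list"
  assumes rows: "distinct rs" "set rs = PG k" and cols: "distinct cs" "set cs = PG k"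
  defines "M \<equiv> nonincidence_matrix rs cs" and "N \<equiv> card (PG k :: 'a vec set set)"
  shows "length rs = N" "length cs = N" "M \<in> carrier_mat N N"
    "real_inverse M \<in> carrier_mat N N" "M * real_inverse M = 1\<^sub>m N" "real_inverse M * M = 1\<^sub>m N"
proof -
  show len: "length rs = N" "length cs = N"
    using distinct_card[OF rows(1)] rows(2) distinct_card[OF cols(1)] cols(2) by (simp_all add: N_def)
  show M: "M \<in> carrier_mat N N" using len by (simp add: M_def nonincidence_matrix_def)
  let ?q = "real (CARD('a))"
  \<comment> \<open>\<open>M M\<^sup>T\<close> is a combination of the identity and the all-ones matrix, whence the inverse is
    a combination of \<open>M\<^sup>T\<close> and the all-ones matrix.\<close>
  define B where "B = mat N N (\<lambda>(j, i). (if representative (rs ! i) \<bullet> representative (cs ! j) = 0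
    then 1 - ?q else 1) / ?q ^ (k - 1))"
  have B: "B \<in> carrier_mat N N" by (simp add: B_def)
  have q: "?q > 1" using two_le_card_field[where 'a = 'a] by simp
  have rsPG: "rs ! i \<in> PG k" if "i < N" for i using that rows(2) len(1) nth_mem[of i rs] by simp
  have "M * B = 1\<^sub>m N"
  proof (rule eq_matI)
    fix i j assume "i < dim_row (1\<^sub>m N)" "j < dim_col (1\<^sub>m N)"
    then have ij: "i < N" "j < N" by auto
    define v v' where "v = representative (rs ! i)" and "v' = representative (rs ! j)"
    note r = representative_PG[OF rsPG[OF ij(1)], folded v_def]
    note r' = representative_PG[OF rsPG[OF ij(2)], folded v'_def]
    define f where "f w = (if v \<bullet> w = 0 then 0 else if v' \<bullet> w = 0 then 1 - ?q else 1)" for w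
    have "(M * B) $$ (i, j) = (\<Sum>l<N. f (representative (cs ! l)) / ?q ^ (k - 1))"
      using ij M B len
      by (auto simp: scalar_prod_def M_def B_def nonincidence_matrix_def f_def v_def v'_def
          lessThan_atLeast0 intro!: sum.cong)
    also have "\<dots> = (\<Sum>l<N. f (representative (cs ! l))) / ?q ^ (k - 1)"
      by (simp add: sum_divide_distrib)
    also have "(\<Sum>l<N. f (representative (cs ! l))) = (\<Sum>p\<in>PG k. f (representative p))"
      using bij_betw_nth[OF cols(1) refl refl] cols(2) len
      by (intro sum.reindex_bij_betw) auto
    \<comment> \<open>The orthogonality sum runs over vectors and so counts every point q - 1 times;
      this factor is cancelled.\<close>
    also have "\<dots> = (if rs ! i = rs ! j then ?q ^ (k - 1) else 0)"
    proof -
      have "(\<Sum>w\<in>carrier_vec k - {0\<^sub>v k}. f w) =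
          of_nat (CARD('a) - 1) * (\<Sum>p\<in>PG k. f (representative p))"
        unfolding PG_def
      proof (rule sum_nonzero_vectors[OF linear_code_carrier_vec])
        fix w u :: "'a vec" assume w: "w \<in> carrier_vec k" "u \<in> point w"
        have "v \<in> carrier_vec k" "v' \<in> carrier_vec k" using r r' by auto
        then show "f u = f w" using point_smult_eq_0(2)[OF w] by (simp add: f_def)
      qed
      moreover have "(\<Sum>w\<in>carrier_vec k - {0\<^sub>v k}. f w) =
          (if point v = point v' then real (CARD('a) - 1) * ?q ^ (k - 1) else 0)"
        unfolding f_def using r r' by (intro sum_nonincidence_orthogonality) auto
      ultimately show ?thesis using q r(2) r'(2) by (auto split: if_splits)
    qed
    finally show "(M * B) $$ (i, j) = 1\<^sub>m N $$ (i, j)"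
      using ij q len rows(1) by (auto simp: nth_eq_iff_index_eq)
  qed (use M B in auto)
  moreover from mat_mult_left_right_inverse[OF M B this] have "B * M = 1\<^sub>m N" .
  moreover from real_inverse_eqI[OF M B calculation] have "real_inverse M = B" .
  ultimately show "real_inverse M \<in> carrier_mat N N" "M * real_inverse M = 1\<^sub>m N" "real_inverse M * M = 1\<^sub>m N"
    using B by auto
qed

section \<open>Weight changes and projections\<close>

text \<open>The multiplicities of the overview. Indices are counted, so repeated functionals count
  repeatedly, while a zero functional counts at no point of \<open>PG k\<close>.\<close>

definition point_count :: "nat \<Rightarrow> (nat \<Rightarrow> ('a :: field) vec) \<Rightarrow> 'a vec set \<Rightarrow> nat" where
  "point_count n a p = card {i. i < n \<and> a i \<in> p}"

lemma mem_PG_iff: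
  assumes p: "p \<in> PG k" and v: "(v :: ('a :: {field, finite}) vec) \<in> carrier_vec k"
  shows "v \<in> p \<longleftrightarrow> v \<noteq> 0\<^sub>v k \<and> point v = p"
proof
  assume "v \<in> p"
  then have vp: "v \<in> point (representative p)" using representative_PG(2)[OF p] by simp
  then have "representative p \<in> point v" using point_eqI point_self by blast
  moreover have "representative p \<noteq> 0\<^sub>v k" using representative_PG(1)[OF p] by simp
  ultimately have "v \<noteq> 0\<^sub>v k" by (auto simp: point_def)
  then show "v \<noteq> 0\<^sub>v k \<and> point v = p" using point_eqI[OF vp] representative_PG(2)[OF p] by simp
qed (use point_self in blast)

lemma point_subset_carrier:
  "p \<in> PG k \<Longrightarrow> p \<subseteq> (carrier_vec k :: ('a :: {field, finite}) vec set)"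
  by (auto simp: PG_eq point_def)

lemma finite_PG: "finite (PG k :: ('a :: {field, finite}) vec set set)"
  unfolding PG_def by (rule finite_proj_points[OF linear_code_carrier_vec])

text \<open>Whether \<open>a i \<bullet> x\<close> vanishes depends only on the point of
  \<open>a i\<close>, so the nonzero coordinates can be grouped by points. The right-hand side is
  the row of M at \<open>x\<close> applied to the multiplicities.\<close>

lemma hamming_weight_encode:
  fixes a :: "nat \<Rightarrow> ('a :: {field, finite}) vec"
  assumes a: "\<And>i. a i \<in> carrier_vec k" and x: "x \<in> carrier_vec k"
  shows "hamming_weight (encode n a x) =
    (\<Sum>p\<in>PG k. if x \<bullet> representative p = 0 then 0 else point_count n a p)"
proof -
  let ?P = "{p \<in> PG k. x \<bullet> representative p \<noteq> 0}"
  have dot: "a i \<bullet> x = 0 \<longleftrightarrow> x \<bullet> representative p = 0" if "a i \<in> p" "p \<in> PG k" for i p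
  proof -
    have "representative p \<in> point (a i)"
      using that mem_PG_iff[OF that(2) a] representative_PG(3)[OF that(2)] by auto
    then show ?thesis using point_smult_eq_0(2)[OF a _ x] comm_scalar_prod[OF a x] by metis
  qed
  have "{i. i < n \<and> a i \<bullet> x \<noteq> 0} = (\<Union>p\<in>?P. {i. i < n \<and> a i \<in> p})"
  proof (intro equalityI subsetI)
    fix i assume "i \<in> {i. i < n \<and> a i \<bullet> x \<noteq> 0}"
    then have i: "i < n" "a i \<bullet> x \<noteq> 0" by auto
    then have "a i \<noteq> 0\<^sub>v k" using x by auto
    then have "point (a i) \<in> PG k" using a by (auto simp: PG_eq)
    then show "i \<in> (\<Union>p\<in>?P. {i. i < n \<and> a i \<in> p})"
      using i dot point_self by blast
  qed (use dot in auto)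
  also have "card \<dots> = (\<Sum>p\<in>?P. card {i. i < n \<and> a i \<in> p})"
    using mem_PG_iff[OF _ a] by (intro card_UN_disjoint) (auto simp: finite_PG)
  also have "\<dots> = (\<Sum>p\<in>PG k. if x \<bullet> representative p = 0 then 0 else point_count n a p)"
    unfolding point_count_def sum.inter_filter[OF finite_PG] by (intro sum.cong) auto
  finally show ?thesis by (simp add: hamming_weight_def encode_def cong: conj_cong)
qed

lemma encode_image_point:
  assumes "\<And>i. a i \<in> carrier_vec k" "v \<in> carrier_vec k"
  shows "encode n a ` point (v :: ('a :: field) vec) = point (encode n a v)"
proof -
  have "point u = (\<lambda>c. c \<cdot>\<^sub>v u) ` (UNIV - {0})" for u :: "'a vec" by (auto simp: point_def)
  then show ?thesis using assms by (simp add: image_image encode_smult[of n a k])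
qed

text \<open>The injection \<open>encode n a\<close> carries the points of F^k bijectively to the
  points of \<open>U\<close>, so the multiset can be indexed by \<open>PG k\<close>, and both
  weights are given by \<open>hamming_weight_encode\<close>.\<close>

lemma weight_changes_encode:
  fixes a b :: "nat \<Rightarrow> ('a :: {field, finite}) vec"
  assumes a: "\<And>i. a i \<in> carrier_vec k" and b: "\<And>i. b i \<in> carrier_vec k"
    and bij: "bij_betw (encode n a) (carrier_vec k) U" and U: "linear_code n U"
    and \<phi>: "\<And>x. x \<in> carrier_vec k \<Longrightarrow> \<phi> (encode n a x) = encode m b x"
  shows "weight_changes n U \<phi> = image_mset (\<lambda>p. \<Sum>r\<in>PG k.
     if representative p \<bullet> representative r = 0 then 0
     else int (point_count n a r) - int (point_count m b r)) (mset_set (PG k))"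
proof -
  let ?F = "\<lambda>p. encode n a ` p"
  have inj: "inj_on (encode n a) (carrier_vec k)" and im: "encode n a ` carrier_vec k = U"
    using bij by (auto simp: bij_betw_def)
  have injF: "inj_on ?F (PG k)"
    by (rule inj_onI) (metis inj inj_on_image_eq_iff point_subset_carrier)
  have "?F ` PG k = (\<lambda>v. point (encode n a v)) ` (carrier_vec k - {0\<^sub>v k})"
    unfolding PG_eq image_image using encode_image_point[of a k, OF a] by (intro image_cong) auto
  also have "\<dots> = point ` (encode n a ` (carrier_vec k - {0\<^sub>v k}))" by (simp add: image_image)
  also have "encode n a ` (carrier_vec k - {0\<^sub>v k}) = U - {0\<^sub>v n}"
    using inj_on_image_set_diff[OF inj, of "carrier_vec k" "{0\<^sub>v k}"] encode_zero[of n a k] a im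
    by simp
  finally have FP: "?F ` PG k = proj_points n U" by (simp add: proj_points_eq[OF U])
  have "weight_changes n U \<phi> =
      image_mset (\<lambda>p. weight_change \<phi> (representative (?F p))) (mset_set (PG k))"
    unfolding weight_changes_def FP[symmetric] image_mset_mset_set[OF injF, symmetric]
    by (simp add: multiset.map_comp comp_def)
  also have "\<dots> = image_mset (\<lambda>p. \<Sum>r\<in>PG k.
     if representative p \<bullet> representative r = 0 then 0
     else int (point_count n a r) - int (point_count m b r)) (mset_set (PG k))"
  proof (rule image_mset_cong)
    fix p assume "p \<in># mset_set (PG k :: 'a vec set set)"
    then have p: "p \<in> PG k" by (simp add: finite_PG)
    define v where "v = representative p"
    note r = representative_PG[OF p, folded v_def]
    have v: "v \<in> carrier_vec k" using r by simp
    have "?F p \<in> proj_points n U" using FP p by auto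
    from representative_point(3)[OF U this] obtain w where
      w: "w \<in> p" "representative (?F p) = encode n a w" by auto
    then obtain c where c: "c \<noteq> 0" "w = c \<cdot>\<^sub>v v" using r(2) by (auto simp: point_def)
    \<comment> \<open>The representative chosen in the image point need not be
      \<open>encode n a v\<close>; it is a multiple by some nonzero \<open>c\<close>, which affects
      neither weight.\<close>
    have "weight_change \<phi> (representative (?F p)) =
        int (hamming_weight (encode n a v)) - int (hamming_weight (encode m b v))"
    proof -
      have "\<phi> (representative (?F p)) = c \<cdot>\<^sub>v encode m b v"
        using w(2) c v b \<phi>[of w] by (simp add: encode_smult[of m b k])
      moreover have "representative (?F p) = c \<cdot>\<^sub>v encode n a v"
        using w(2) c v a by (simp add: encode_smult[of n a k])
      ultimately show ?thesis by (simp add: weight_change_def hamming_weight_smult c(1))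
    qed
    also have "\<dots> = (\<Sum>r\<in>PG k. if v \<bullet> representative r = 0 then 0
        else int (point_count n a r) - int (point_count m b r))"
      unfolding hamming_weight_encode[of a k, OF a v] hamming_weight_encode[of b k, OF b v]
      by (auto simp: sum_subtractf[symmetric] intro!: sum.cong)
    finally show "weight_change \<phi> (representative (?F p)) = (\<Sum>r\<in>PG k.
        if representative p \<bullet> representative r = 0 then 0
        else int (point_count n a r) - int (point_count m b r))" by (simp add: v_def)
  qed
  finally show ?thesis .
qed

section \<open>Projections as domination of multiplicities\<close>

lemma scalar_prod_left_cancel:
  fixes a b :: "('a :: field) vec"
  assumes "a \<in> carrier_vec k" "b \<in> carrier_vec k"
    and "\<And>x. x \<in> carrier_vec k \<Longrightarrow> a \<bullet> x = b \<bullet> x"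
  shows "a = b"
proof (rule eq_vecI)
  fix i assume "i < dim_vec b"
  then have "i < k" using assms(2) by simp
  then show "a $ i = b $ i" using assms(3)[of "unit_vec k i"] assms(1,2) by simp
qed (use assms in simp)

text \<open>Given a matrix, the single nonzero entry in row \<open>i\<close> selects a column
  \<open>j\<close> with \<open>a j\<close> in the point of \<open>b i\<close>, and the column
  condition makes this selection injective. Conversely, injections between the index sets over the
  individual points are glued, and the scalars relating matched functionals become the matrix
  entries.\<close>

lemma is_projection_iff_point_count_le:
  fixes a b :: "nat \<Rightarrow> ('a :: {field, finite}) vec"
  assumes a: "\<And>i. a i \<in> carrier_vec k" and b: "\<And>i. b i \<in> carrier_vec k"
    and U: "U = encode n a ` carrier_vec k"
    and \<phi>: "\<And>x. x \<in> carrier_vec k \<Longrightarrow> \<phi> (encode n a x) = encode m b x"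
  shows "is_projection n m U \<phi> \<longleftrightarrow> (\<forall>p\<in>PG k. point_count m b p \<le> point_count n a p)"
proof
  assume "is_projection n m U \<phi>"
  then obtain A where A: "A \<in> carrier_mat m n"
    and row: "\<And>i. i < m \<Longrightarrow> card {j. j < n \<and> A $$ (i, j) \<noteq> 0} \<le> 1"
    and col: "\<And>j. j < n \<Longrightarrow> card {i. i < m \<and> A $$ (i, j) \<noteq> 0} \<le> 1"
    and mult: "\<And>u. u \<in> U \<Longrightarrow> \<phi> u = A *\<^sub>v u"
    unfolding is_projection_def by blast
  have eq: "b i \<bullet> x = (\<Sum>j<n. A $$ (i, j) * (a j \<bullet> x))" if i: "i < m" and x: "x \<in> carrier_vec k" for i x
  proof -
    have "encode m b x = A *\<^sub>v encode n a x" using \<phi>[OF x] mult U x by auto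
    then have "encode m b x $ i = (A *\<^sub>v encode n a x) $ i" by simp
    then show ?thesis using i A
      by (simp add: encode_def scalar_prod_def lessThan_atLeast0)
  qed
  show "\<forall>p\<in>PG k. point_count m b p \<le> point_count n a p"
  proof
    fix p :: "'a vec set" assume p: "p \<in> PG k"
    have "\<exists>j. j < n \<and> A $$ (i, j) \<noteq> 0 \<and> a j \<in> p" if i: "i < m" "b i \<in> p" for i
    proof -
      have bi: "b i \<noteq> 0\<^sub>v k" "point (b i) = p" using i mem_PG_iff[OF p b] by auto
      have "\<exists>j<n. A $$ (i, j) \<noteq> 0"
      proof (rule ccontr)
        assume "\<not> (\<exists>j<n. A $$ (i, j) \<noteq> 0)"
        then have "b i \<bullet> x = 0\<^sub>v k \<bullet> x" if "x \<in> carrier_vec k" for x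
          using eq[OF i(1) that] that by simp
        then have "b i = 0\<^sub>v k"
          by (intro scalar_prod_left_cancel[OF b]) auto
        with bi show False by simp
      qed
      then obtain j where j: "j < n" "A $$ (i, j) \<noteq> 0" by blast
      have other: "A $$ (i, j') = 0" if "j' < n" "j' \<noteq> j" for j'
      proof (rule ccontr)
        assume "A $$ (i, j') \<noteq> 0"
        then have "card {j, j'} \<le> card {j. j < n \<and> A $$ (i, j) \<noteq> 0}"
          using j that by (intro card_mono) auto
        with row[OF i(1)] that(2) show False by simp
      qed
      have "b i \<bullet> x = (A $$ (i, j) \<cdot>\<^sub>v a j) \<bullet> x" if x: "x \<in> carrier_vec k" for x
      proof -
        have "b i \<bullet> x = (\<Sum>j'<n. if j' = j then A $$ (i, j) * (a j \<bullet> x) else 0)"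
          unfolding eq[OF i(1) x] using other by (intro sum.cong) auto
        then show ?thesis using j a[of j] x by simp
      qed
      then have "b i = A $$ (i, j) \<cdot>\<^sub>v a j"
        using a by (intro scalar_prod_left_cancel[OF b]) auto
      then have "b i \<in> point (a j)" using j by (auto simp: point_def)
      then have "a j \<in> p" using bi point_eqI point_self by metis
      with j show ?thesis by blast
    qed
    then obtain \<sigma> where \<sigma>: "\<And>i. i < m \<Longrightarrow> b i \<in> p \<Longrightarrow> \<sigma> i < n \<and> A $$ (i, \<sigma> i) \<noteq> 0 \<and> a (\<sigma> i) \<in> p"
      by metis
    have "inj_on \<sigma> {i. i < m \<and> b i \<in> p}"
    proof (rule inj_onI, rule ccontr)
      fix i i' assume i: "i \<in> {i. i < m \<and> b i \<in> p}" "i' \<in> {i. i < m \<and> b i \<in> p}"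
        "\<sigma> i = \<sigma> i'" "i \<noteq> i'"
      have "card {i, i'} \<le> card {l. l < m \<and> A $$ (l, \<sigma> i) \<noteq> 0}"
        using i \<sigma>[of i] \<sigma>[of i'] by (intro card_mono) auto
      with col[of "\<sigma> i"] \<sigma>[of i] i show False by simp
    qed
    then show "point_count m b p \<le> point_count n a p"
      unfolding point_count_def using \<sigma> by (intro card_inj_on_le[of \<sigma>]) auto
  qed
next
  assume le: "\<forall>p\<in>PG k. point_count m b p \<le> point_count n a p"
  have "\<forall>p\<in>PG k. \<exists>f. f ` {i. i < m \<and> b i \<in> p} \<subseteq> {j. j < n \<and> a j \<in> p} \<and>
      inj_on f {i. i < m \<and> b i \<in> p}"
    using le unfolding point_count_def by (intro ballI card_le_inj) auto
  from bchoice[OF this] obtain f where f: "\<And>p. p \<in> PG k \<Longrightarrow> f p ` {i. i < m \<and> b i \<in> p} \<subseteq> {j. j < n \<and> a j \<in> p}"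
    and inj: "\<And>p. p \<in> PG k \<Longrightarrow> inj_on (f p) {i. i < m \<and> b i \<in> p}"
    by blast
  \<comment> \<open>Only nonzero functionals belong to a point and need a partner; the other rows of
    \<open>A\<close> are zero.\<close>
  define I where "I = {i. i < m \<and> b i \<noteq> 0\<^sub>v k}"
  define \<sigma> where "\<sigma> i = f (point (b i)) i" for i
  have pb: "point (b i) \<in> PG k" if "i \<in> I" for i using that b by (auto simp: I_def PG_eq)
  have \<sigma>: "\<sigma> i < n" "a (\<sigma> i) \<in> point (b i)" if "i \<in> I" for i
    using f[OF pb[OF that]] that point_self by (auto simp: \<sigma>_def I_def)
  have inj\<sigma>: "i = i'" if "i \<in> I" "i' \<in> I" "\<sigma> i = \<sigma> i'" for i i'
  proof -
    \<comment> \<open>The common partner lies in both points, so they coincide and injectivity over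
      that single point suffices.\<close>
    have "point (b i) = point (b i')" using \<sigma>(2)[OF that(1)] \<sigma>(2)[OF that(2)] that(3) point_eqI by metis
    then show ?thesis
      using inj[OF pb[OF that(1)]] that point_self[of "b i"] point_self[of "b i'"]
      by (auto simp: \<sigma>_def I_def inj_on_def)
  qed
  have "\<exists>c. b i = c \<cdot>\<^sub>v a (\<sigma> i)" if "i \<in> I" for i
  proof -
    have "b i \<in> point (a (\<sigma> i))" using \<sigma>(2)[OF that] point_eqI point_self by metis
    then show ?thesis by (auto simp: point_def)
  qed
  then obtain c where c: "\<And>i. i \<in> I \<Longrightarrow> b i = c i \<cdot>\<^sub>v a (\<sigma> i)" by metis
  define A where "A = mat m n (\<lambda>(i, j). if i \<in> I \<and> j = \<sigma> i then c i else 0)"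
  have A: "A \<in> carrier_mat m n" by (simp add: A_def)
  have row: "card {j. j < n \<and> A $$ (i, j) \<noteq> 0} \<le> 1" if "i < m" for i
  proof -
    have "{j. j < n \<and> A $$ (i, j) \<noteq> 0} \<subseteq> {\<sigma> i}" using that by (auto simp: A_def split: if_splits)
    from card_mono[OF _ this] show ?thesis by simp
  qed
  have col: "card {i. i < m \<and> A $$ (i, j) \<noteq> 0} \<le> 1" if j: "j < n" for j
  proof -
    have "i = i'" if "i \<in> {i. i < m \<and> A $$ (i, j) \<noteq> 0}" "i' \<in> {i. i < m \<and> A $$ (i, j) \<noteq> 0}" for i i'
      using that j inj\<sigma>[of i i'] by (auto simp: A_def split: if_splits)
    then show ?thesis by (simp add: card_le_Suc0_iff_eq)
  qed
  have "encode m b x = A *\<^sub>v encode n a x" if x: "x \<in> carrier_vec k" for x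
  proof (rule eq_vecI)
    fix i assume "i < dim_vec (A *\<^sub>v encode n a x)"
    then have i: "i < m" using A by simp
    have "(A *\<^sub>v encode n a x) $ i = (\<Sum>j<n. if i \<in> I \<and> j = \<sigma> i then c i * (a (\<sigma> i) \<bullet> x) else 0)"
      using i A by (auto simp: encode_def scalar_prod_def lessThan_atLeast0 A_def intro!: sum.cong)
    also have "\<dots> = b i \<bullet> x"
    proof (cases "i \<in> I")
      case True
      then show ?thesis using \<sigma>(1)[OF True] a[of "\<sigma> i"] x by (simp add: c)
    next
      case False
      then have "b i = 0\<^sub>v k" using i by (simp add: I_def)
      then show ?thesis using False x by simp
    qed
    finally show "encode m b x $ i = (A *\<^sub>v encode n a x) $ i" using i by (simp add: encode_def)
  qed (use A in \<open>simp add: encode_def\<close>)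
  then have "\<forall>u\<in>U. \<phi> u = A *\<^sub>v u" using U \<phi> by auto
  then show "is_projection n m U \<phi>"
    unfolding is_projection_def using A row col by blast
qed

section \<open>Functionals with prescribed multiplicities\<close>

lemma ex_point_count_eq:
  fixes \<alpha> :: "('a :: {field, finite}) vec set \<Rightarrow> nat"
  shows "\<exists>n a. (\<forall>i. a i \<in> carrier_vec k) \<and> (\<forall>p\<in>PG k. point_count n a p = \<alpha> p)"
proof -
  obtain ps where ps: "distinct ps" "set ps = (PG k :: 'a vec set set)"
    using finite_distinct_list[OF finite_PG] by blast
  \<comment> \<open>Each point contributes its representative with the required multiplicity. Points
    are pairwise disjoint, so the entries in \<open>p\<close> are exactly the block of
    \<open>p\<close>.\<close>
  define as where "as = concat (map (\<lambda>p. replicate (\<alpha> p) (representative p)) ps)"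
  \<comment> \<open>The default value keeps the whole family in \<open>carrier_vec k\<close>; it
    occurs only at positions beyond the counted range.\<close>
  define a where "a i = (if i < length as then as ! i else 0\<^sub>v k)" for i
  have "set as \<subseteq> carrier_vec k" using ps by (auto simp: as_def dest: representative_PG(1))
  then have "\<forall>i. a i \<in> carrier_vec k" using nth_mem by (fastforce simp: a_def)
  moreover have "point_count (length as) a p = \<alpha> p" if p: "p \<in> PG k" for p
  proof -
    have "point_count (length as) a p = length (filter (\<lambda>v. v \<in> p) as)"
      unfolding point_count_def length_filter_conv_card by (intro arg_cong[where f = card]) (auto simp: a_def)
    also have "\<dots> = sum_list (map (\<lambda>r. if r = p then \<alpha> p else 0) ps)"
    proof -
      have "(representative r \<in> p) = (r = p)" if "r \<in> set ps" for r
        using representative_PG[of r k] that ps mem_PG_iff[OF p, of "representative r"] by auto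
      then show ?thesis
        by (auto simp: as_def filter_concat length_concat comp_def intro!: arg_cong[where f = sum_list])
    qed
    also have "\<dots> = \<alpha> p"
      using ps p by (simp add: sum_list_distinct_conv_sum_set finite_PG)
    finally show ?thesis .
  qed
  ultimately show ?thesis by blast
qed

text \<open>In particular the points of the unit vectors occur among the \<open>a i\<close>, so
  every coordinate of \<open>x\<close> can be read off from the codeword up to a known nonzero
  scalar.\<close>

lemma encode_inj_on:
  fixes a :: "nat \<Rightarrow> ('a :: {field, finite}) vec"
  assumes a: "\<And>i. a i \<in> carrier_vec k" and pos: "\<And>p. p \<in> PG k \<Longrightarrow> point_count n a p > 0"
  shows "inj_on (encode n a) (carrier_vec k)"
proof (rule inj_onI)
  fix x y assume x: "x \<in> carrier_vec k" and y: "y \<in> carrier_vec k" and eq: "encode n a x = encode n a y"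
  have "x $ l = y $ l" if l: "l < k" for l
  proof -
    have "unit_vec k l \<noteq> (0\<^sub>v k :: 'a vec)"
      using l by (metis index_unit_vec(1) index_zero_vec(1) zero_neq_one)
    then have p: "point (unit_vec k l :: 'a vec) \<in> PG k" by (auto simp: PG_eq)
    have "{i. i < n \<and> a i \<in> point (unit_vec k l)} \<noteq> {}"
      using pos[OF p] unfolding point_count_def by (metis card.empty less_irrefl)
    then obtain i where i: "i < n" "a i \<in> point (unit_vec k l)" by blast
    then obtain c where c: "c \<noteq> 0" "a i = c \<cdot>\<^sub>v unit_vec k l" by (auto simp: point_def)
    have "a i \<bullet> x = a i \<bullet> y" using arg_cong[OF eq, of "\<lambda>v. v $ i"] i by (simp add: encode_def)
    then show ?thesis using c x y l by simp
  qed
  then show "x = y" using x y by (intro eq_vecI) auto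
qed

section \<open>Sizes of projective spaces and the action of M on functions of points\<close>

lemma card_PG: "CARD('a) ^ k - 1 = (CARD('a) - 1) * card (PG k :: ('a :: {field, finite}) vec set set)"
  unfolding PG_def card_proj_points[OF linear_code_carrier_vec, symmetric] card_carrier_vec ..

text \<open>This recovers the dimension of a code from the size of its multiset of weight changes,
  because powers of q with q at least 2 determine their exponents.\<close>

lemma card_PG_inject:
  assumes "card (PG d :: ('a :: {field, finite}) vec set set) = card (PG k :: 'a vec set set)"
  shows "d = k"
proof -
  have q: "2 \<le> CARD('a)" by (rule two_le_card_field)
  have "CARD('a) ^ d - 1 = CARD('a) ^ k - 1" using assms card_PG[where 'a = 'a] by metis
  then have "CARD('a) ^ d = CARD('a) ^ k" using q by (simp add: eq_diff_iff)
  then show ?thesis using q by (simp add: power_inject_exp)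
qed

text \<open>Writing the vector as a function \<open>g\<close> on points removes the column order and
  yields the sum in \<open>weight_changes_encode\<close>.\<close>

lemma nonincidence_matrix_mult_vec:
  fixes rs cs :: "('a :: {field, finite}) vec set list" and g :: "'a vec set \<Rightarrow> int"
  assumes cols: "distinct cs" "set cs = PG k" and i: "i < length rs"
  shows "(nonincidence_matrix rs cs *\<^sub>v vec (length cs) (\<lambda>j. real_of_int (g (cs ! j)))) $ i =
    real_of_int (\<Sum>r\<in>PG k. if representative (rs ! i) \<bullet> representative r = 0 then 0 else g r)"
proof -
  let ?h = "\<lambda>r. if representative (rs ! i) \<bullet> representative r = 0 then 0 else g r"
  have "(nonincidence_matrix rs cs *\<^sub>v vec (length cs) (\<lambda>j. real_of_int (g (cs ! j)))) $ i =
      (\<Sum>j<length cs. real_of_int (?h (cs ! j)))"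
    using i by (auto simp: nonincidence_matrix_def scalar_prod_def lessThan_atLeast0 intro!: sum.cong)
  also have "\<dots> = (\<Sum>r\<in>PG k. real_of_int (?h r))"
    using bij_betw_nth[OF cols(1) refl cols(2)[symmetric]] by (intro sum.reindex_bij_betw)
  finally show ?thesis by simp
qed

lemma mset_list_of_vec_vec:
  assumes "distinct rs" "set rs = P"
  shows "mset (list_of_vec (vec (length rs) (\<lambda>i. f (rs ! i)))) = image_mset f (mset_set P)"
proof -
  have "list_of_vec (vec (length rs) (\<lambda>i. f (rs ! i))) = map f rs"
    by (intro nth_equalityI) simp_all
  moreover have "mset rs = mset_set P" using assms mset_set_set by metis
  ultimately show ?thesis by (metis mset_map)
qed


lemma mset_nonincidence_matrix_mult:
  fixes rs cs :: "('a :: {field, finite}) vec set list"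
  assumes rows: "distinct rs" "set rs = PG k" and cols: "distinct cs" "set cs = PG k"
    and \<pi>: "map_vec real_of_int \<pi> =
      nonincidence_matrix rs cs *\<^sub>v vec (length cs) (\<lambda>j. real_of_int (g (cs ! j)))"
  shows "mset (list_of_vec \<pi>) = image_mset (\<lambda>p. \<Sum>r\<in>PG k.
     if representative p \<bullet> representative r = 0 then 0 else g r) (mset_set (PG k))"
proof -
  let ?f = "\<lambda>p. \<Sum>r\<in>PG k. if representative p \<bullet> representative r = 0 then 0 else g r"
  have "\<pi> = vec (length rs) (\<lambda>i. ?f (rs ! i))"
  proof (rule eq_vecI)
    show dim: "dim_vec \<pi> = dim_vec (vec (length rs) (\<lambda>i. ?f (rs ! i)))"
      using arg_cong[OF \<pi>, of dim_vec] by (simp add: nonincidence_matrix_def)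
    fix i assume "i < dim_vec (vec (length rs) (\<lambda>i. ?f (rs ! i)))"
    then have i: "i < length rs" by simp
    have "real_of_int (\<pi> $ i) = map_vec real_of_int \<pi> $ i" using i dim by simp
    also have "\<dots> = real_of_int (?f (rs ! i))"
      unfolding \<pi> by (rule nonincidence_matrix_mult_vec[OF cols i])
    finally show "\<pi> $ i = vec (length rs) (\<lambda>i. ?f (rs ! i)) $ i"
      using i by (simp del: of_int_sum)
  qed
  then show ?thesis using mset_list_of_vec_vec[OF rows, of ?f] by simp
qed

section \<open>The two implications\<close>

lemma projection_forcing_imp_nonneg:
  fixes rs cs :: "('a :: {field, finite}) vec set list"
  assumes rows: "distinct rs" "set rs = PG k" and cols: "distinct cs" "set cs = PG k"
    and forcing: "projection_forcing TYPE('a) (mset (list_of_vec \<pi>))"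
    and \<pi>: "map_vec real_of_int \<pi> =
      nonincidence_matrix rs cs *\<^sub>v vec (length cs) (\<lambda>j. real_of_int (g (cs ! j)))"
    and p: "p \<in> PG k"
  shows "g p \<ge> 0"
proof -
  \<comment> \<open>Positive and negative part of \<open>g\<close>, each raised by 1: the difference
    is \<open>g\<close>, and the increment gives every point the positive count that makes
    \<open>encode n a\<close> injective. The increment for \<open>b\<close> balances it.\<close>
  obtain n and a :: "nat \<Rightarrow> 'a vec" where a: "\<And>i. a i \<in> carrier_vec k"
    and na: "\<And>p. p \<in> PG k \<Longrightarrow> point_count n a p = nat (g p) + 1"
    using ex_point_count_eq[of k "\<lambda>p. nat (g p) + 1"] by blast
  obtain m and b :: "nat \<Rightarrow> 'a vec" where b: "\<And>i. b i \<in> carrier_vec k"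
    and mb: "\<And>p. p \<in> PG k \<Longrightarrow> point_count m b p = nat (- g p) + 1"
    using ex_point_count_eq[of k "\<lambda>p. nat (- g p) + 1"] by blast
  have inj: "inj_on (encode n a) (carrier_vec k)"
    by (rule encode_inj_on[of a, OF a]) (simp add: na)
  define U where "U = encode n a ` carrier_vec k"
  \<comment> \<open>Decode with \<open>a\<close> and encode again with \<open>b\<close>; on
    \<open>U\<close> this is well defined by injectivity.\<close>
  define \<phi> where "\<phi> u = encode m b (the_inv_into (carrier_vec k) (encode n a) u)" for u
  have \<phi>: "\<phi> (encode n a x) = encode m b x" if "x \<in> carrier_vec k" for x
    using that by (simp add: \<phi>_def the_inv_into_f_f[OF inj])
  have U: "linear_code n U"
    unfolding linear_code_iff
  proof (intro conjI ballI allI)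
    show "0\<^sub>v n \<in> U" unfolding U_def using encode_zero[of n a k] a by (metis imageI zero_carrier_vec)
    show "u + v \<in> U" if "u \<in> U" "v \<in> U" for u v
      using that unfolding U_def
      by (auto simp: encode_add[of n a k, OF a, symmetric])
    show "c \<cdot>\<^sub>v u \<in> U" if "u \<in> U" for c u
      using that unfolding U_def by (auto simp: encode_smult[of n a k, OF a, symmetric])
  qed (auto simp: U_def)
  have "\<phi> (u + v) = \<phi> u + \<phi> v" if uv: "u \<in> U" "v \<in> U" for u v
  proof -
    obtain x y where x: "x \<in> carrier_vec k" "u = encode n a x"
      and y: "y \<in> carrier_vec k" "v = encode n a y"
      using uv by (auto simp: U_def)
    then have "u + v = encode n a (x + y)" using a by (simp add: encode_add[of n a k])
    then show ?thesis using x y b by (simp add: \<phi> encode_add[of m b k])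
  qed
  moreover have "\<phi> (c \<cdot>\<^sub>v u) = c \<cdot>\<^sub>v \<phi> u" if u: "u \<in> U" for c u
  proof -
    obtain x where x: "x \<in> carrier_vec k" "u = encode n a x" using u by (auto simp: U_def)
    then have "c \<cdot>\<^sub>v u = encode n a (c \<cdot>\<^sub>v x)" using a by (simp add: encode_smult[of n a k])
    then show ?thesis using x b by (simp add: \<phi> encode_smult[of m b k])
  qed
  ultimately have code: "code_map n m U (carrier_vec m) \<phi>"
    using U linear_code_carrier_vec by (auto simp: code_map_iff \<phi>_def)
  have "bij_betw (encode n a) (carrier_vec k) U" using inj by (simp add: bij_betw_def U_def)
  then have "weight_changes n U \<phi> = image_mset (\<lambda>p. \<Sum>r\<in>PG k.
     if representative p \<bullet> representative r = 0 then 0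
     else int (point_count n a r) - int (point_count m b r)) (mset_set (PG k))"
    by (rule weight_changes_encode[of a k b n U \<phi> m, OF a b _ U \<phi>])
  also have "\<dots> = mset (list_of_vec \<pi>)"
    unfolding mset_nonincidence_matrix_mult[OF rows cols \<pi>]
    by (intro image_mset_cong sum.cong) (auto simp: na mb)
  finally have "is_projection n m U \<phi>"
    using forcing code unfolding projection_forcing_def by blast
  then have "point_count m b p \<le> point_count n a p"
    using is_projection_iff_point_count_le[of a k b U n \<phi> m, OF a b U_def \<phi>] p by blast
  then show ?thesis using na mb p by simp
qed

text \<open>In coordinates the code map becomes a pair of families \<open>a\<close>,
  \<open>b\<close>. Its weight changes, listed in the order \<open>rs\<close>, are M applied to the
  difference \<open>g\<close> of multiplicities, so \<open>nonneg\<close> for this one vector gives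
  the projection criterion. Stating \<open>nonneg\<close> through \<open>g\<close> expresses
  integrality without the inverse matrix.\<close>

lemma is_projection_if_nonneg:
  fixes rs cs :: "('a :: {field, finite}) vec set list"
  assumes rows: "distinct rs" "set rs = PG k" and cols: "distinct cs" "set cs = PG k"
    and code: "code_map n m (U :: 'a vec set) V \<phi>"
    and size: "size (weight_changes n U \<phi>) = card (PG k :: 'a vec set set)"
    and nonneg: "\<And>\<pi> g. mset (list_of_vec \<pi>) = weight_changes n U \<phi> \<Longrightarrow> map_vec real_of_int \<pi> =
      nonincidence_matrix rs cs *\<^sub>v vec (length cs) (\<lambda>j. real_of_int (g (cs ! j))) \<Longrightarrow>
      \<forall>p\<in>PG k. g p \<ge> 0"
  shows "is_projection n m U \<phi>"
proof -
  have U: "linear_code n U" and V: "linear_code m V" and UV: "\<phi> ` U \<subseteq> V"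
    and add: "\<And>u v. u \<in> U \<Longrightarrow> v \<in> U \<Longrightarrow> \<phi> (u + v) = \<phi> u + \<phi> v"
    and smult: "\<And>c u. u \<in> U \<Longrightarrow> \<phi> (c \<cdot>\<^sub>v u) = c \<cdot>\<^sub>v \<phi> u"
    using code by (auto simp: code_map_iff)
  obtain d and a :: "nat \<Rightarrow> 'a vec" where a': "\<And>i. a i \<in> carrier_vec d"
    and bij': "bij_betw (encode n a) (carrier_vec d) U"
    using linear_code_eq_encode[OF U] by blast
  have enc: "encode n a x \<in> U" if "x \<in> carrier_vec d" for x using that bij' by (auto simp: bij_betw_def)
  have "\<exists>b. (\<forall>i. b i \<in> carrier_vec d) \<and> (\<forall>x\<in>carrier_vec d. \<phi> (encode n a x) = encode m b x)"
  proof (rule linear_eq_encode)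
    show "\<phi> (encode n a x) \<in> carrier_vec m" if "x \<in> carrier_vec d" for x
      using enc[OF that] UV V by (auto simp: linear_code_iff)
  qed (simp_all add: encode_add[of n a d] encode_smult[of n a d] a' add smult enc)
  then obtain b where b': "\<And>i. b i \<in> carrier_vec d"
    and \<phi>': "\<And>x. x \<in> carrier_vec d \<Longrightarrow> \<phi> (encode n a x) = encode m b x" by blast
  define g where "g r = int (point_count n a r) - int (point_count m b r)" for r
  have wc': "weight_changes n U \<phi> = image_mset (\<lambda>p. \<Sum>r\<in>PG d.
      if representative p \<bullet> representative r = 0 then 0 else g r) (mset_set (PG d))"
    unfolding g_def by (rule weight_changes_encode[of a d b, OF a' b' bij' U \<phi>'])
  \<comment> \<open>There is one weight change per point of \<open>PG d\<close>, so the size of the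
    multiset fixes the dimension of \<open>U\<close>.\<close>
  have "card (PG d :: 'a vec set set) = card (PG k :: 'a vec set set)"
    using size unfolding wc' by simp
  then have "d = k" by (rule card_PG_inject)
  note a = a'[unfolded this] and b = b'[unfolded this] and bij = bij'[unfolded this] and \<phi> = \<phi>'[unfolded this]
    and wc = wc'[unfolded this]
  define \<pi> where "\<pi> = vec (length rs) (\<lambda>i. \<Sum>r\<in>PG k.
    if representative (rs ! i) \<bullet> representative r = 0 then 0 else g r)"
  have \<pi>: "map_vec real_of_int \<pi> =
      nonincidence_matrix rs cs *\<^sub>v vec (length cs) (\<lambda>j. real_of_int (g (cs ! j)))" (is "_ = ?y")
  proof (rule eq_vecI)
    show "dim_vec (map_vec real_of_int \<pi>) = dim_vec ?y" by (simp add: \<pi>_def nonincidence_matrix_def)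
    fix i assume "i < dim_vec ?y"
    then have "i < length rs" by (simp add: nonincidence_matrix_def)
    then show "map_vec real_of_int \<pi> $ i = ?y $ i"
      unfolding nonincidence_matrix_mult_vec[OF cols \<open>i < length rs\<close>] by (simp add: \<pi>_def)
  qed
  have "mset (list_of_vec \<pi>) = weight_changes n U \<phi>"
    unfolding wc mset_nonincidence_matrix_mult[OF rows cols \<pi>] ..
  from nonneg[OF this \<pi>] have "\<forall>p\<in>PG k. point_count m b p \<le> point_count n a p"
    by (simp add: g_def)
  moreover have "U = encode n a ` carrier_vec k" using bij by (simp add: bij_betw_def)
  ultimately show ?thesis
    using is_projection_iff_point_count_le[of a k b U n \<phi> m, OF a b _ \<phi>] by blast
qed

theorem theorem1p12:
  fixes k q :: nat
    and S :: "int multiset"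
    and rs cs :: "('a :: {field, finite}) vec set list"
  assumes q: "CARD('a) = q"
    and size: "size S = (q ^ k - 1) div (q - 1)"
    and rows: "distinct rs" "set rs = PG k"
    and cols: "distinct cs" "set cs = PG k"
  shows "projection_forcing TYPE('a) S \<longleftrightarrow>
    (\<forall>\<pi> :: int vec. mset (list_of_vec \<pi>) = S \<longrightarrow>
      (let y = real_inverse (nonincidence_matrix rs cs) *\<^sub>v map_vec real_of_int \<pi>
       in (\<forall>i < dim_vec y. y $ i \<ge> 0) \<or> (\<exists>i < dim_vec y. y $ i \<notin> \<int>)))"
proof -
  define M where "M = nonincidence_matrix rs cs"
  define N where "N = card (PG k :: 'a vec set set)"
  note inv = real_inverse_nonincidence_matrix[OF rows cols, folded M_def N_def]
  have sizeN: "size S = N"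
  proof -
    have "CARD('a) - 1 \<noteq> 0" using two_le_card_field[where 'a = 'a] by linarith
    then show ?thesis
      unfolding size q[symmetric] card_PG N_def by (rule nonzero_mult_div_cancel_left)
  qed
  have index: "\<exists>j<N. p = cs ! j" if "p \<in> PG k" for p
    using that cols(2) inv(2) by (metis in_set_conv_nth)
  show ?thesis
  proof (intro iffI allI impI)
    fix \<pi> :: "int vec"
    assume forcing: "projection_forcing TYPE('a) S" and \<pi>: "mset (list_of_vec \<pi>) = S"
    define y where "y = real_inverse M *\<^sub>v map_vec real_of_int \<pi>"
    have "dim_vec \<pi> = N"
      unfolding sizeN[symmetric] \<pi>[symmetric] size_mset Matrix.length_list_of_vec ..
    then have dim: "map_vec real_of_int \<pi> \<in> carrier_vec N"
      by (intro carrier_vecI) simp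
    have y: "y \<in> carrier_vec N" using inv(4) dim by (simp add: y_def)
    have My: "M *\<^sub>v y = map_vec real_of_int \<pi>"
      unfolding y_def using inv(3-5) dim by (simp add: assoc_mult_mat_vec[symmetric])
    \<comment> \<open>The disjunction is proved as an implication: if all entries are integers, they
      are nonnegative.\<close>
    have "y $ i \<ge> 0" if int: "\<forall>i<N. y $ i \<in> \<int>" and i: "i < N" for i
    proof -
      \<comment> \<open>This turns the integral vector, indexed by positions in \<open>cs\<close>,
        into an integer function of points; the floor only changes the type.\<close>
      define g where "g p = \<lfloor>y $ the_inv_into {..<N} ((!) cs) p\<rfloor>" for p
      have g: "real_of_int (g (cs ! j)) = y $ j" if "j < N" for j
      proof -
        have "inj_on ((!) cs) {..<N}" using cols(1) inv(2) by (simp add: inj_on_nth)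
        then have "the_inv_into {..<N} ((!) cs) (cs ! j) = j" using that by (simp add: the_inv_into_f_f)
        then show ?thesis using that int by (auto simp: g_def elim: Ints_cases)
      qed
      have "y = vec (length cs) (\<lambda>j. real_of_int (g (cs ! j)))"
        using y inv(2) g by (intro eq_vecI) auto
      then have "map_vec real_of_int \<pi> = nonincidence_matrix rs cs *\<^sub>v vec (length cs) (\<lambda>j. real_of_int (g (cs ! j)))"
        using My M_def by simp
      then have "g (cs ! i) \<ge> 0"
        using projection_forcing_imp_nonneg[OF rows cols, of \<pi> g] forcing \<pi> i inv(2) cols(2) nth_mem[of i cs] by simp
      then show ?thesis using g[OF i] by simp
    qed
    then have "(\<forall>i < dim_vec y. y $ i \<ge> 0) \<or> (\<exists>i < dim_vec y. y $ i \<notin> \<int>)" using y by auto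
    then show "let y = real_inverse (nonincidence_matrix rs cs) *\<^sub>v map_vec real_of_int \<pi>
       in (\<forall>i < dim_vec y. y $ i \<ge> 0) \<or> (\<exists>i < dim_vec y. y $ i \<notin> \<int>)"
      by (simp only: Let_def y_def M_def)
  next
    assume *: "\<forall>\<pi> :: int vec. mset (list_of_vec \<pi>) = S \<longrightarrow>
      (let y = real_inverse (nonincidence_matrix rs cs) *\<^sub>v map_vec real_of_int \<pi>
       in (\<forall>i < dim_vec y. y $ i \<ge> 0) \<or> (\<exists>i < dim_vec y. y $ i \<notin> \<int>))"
    show "projection_forcing TYPE('a) S"
      unfolding projection_forcing_def
    proof (intro allI impI, elim conjE)
      fix n m and U V :: "'a vec set" and \<phi>
      assume code: "code_map n m U V \<phi>" and S: "weight_changes n U \<phi> = S"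
      show "is_projection n m U \<phi>"
      proof (rule is_projection_if_nonneg[OF rows cols code])
        show "size (weight_changes n U \<phi>) = card (PG k :: 'a vec set set)"
          using S sizeN by (simp add: N_def)
        fix \<pi> :: "int vec" and g :: "'a vec set \<Rightarrow> int"
        let ?z = "vec (length cs) (\<lambda>j. real_of_int (g (cs ! j)))"
        assume \<pi>: "mset (list_of_vec \<pi>) = weight_changes n U \<phi>"
          "map_vec real_of_int \<pi> = nonincidence_matrix rs cs *\<^sub>v ?z"
        have z: "?z \<in> carrier_vec N" unfolding inv(2)[symmetric] by (rule vec_carrier)
        have "real_inverse M *\<^sub>v map_vec real_of_int \<pi> = ?z"
          unfolding \<pi>(2) M_def[symmetric] using inv(3,4,6) z by (simp add: assoc_mult_mat_vec[symmetric])
        \<comment> \<open>The entries of \<open>?z\<close> are integers, so only the first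
          alternative can hold, and every point occurs in \<open>cs\<close>.\<close>
        with * \<pi>(1) S have "(\<forall>i < dim_vec ?z. ?z $ i \<ge> 0) \<or> (\<exists>i < dim_vec ?z. ?z $ i \<notin> \<int>)"
          unfolding Let_def M_def by metis
        then show "\<forall>p\<in>PG k. g p \<ge> 0" using index inv(2) by fastforce
      qed
    qed
  qed
qed

end
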